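(* Let $\alpha,\beta>0$ with $\alpha\beta=\pi^2$. Then for every non-negative integer $k$, \begin{align*} &\alpha^{-1/4}\,{}_2F_1\left(-2k,1;\frac32;2\right)+4\alpha^{3/4}\int_{0}^{\infty}\frac{xe^{-\alpha x^2}}{e^{2\pi x}-1}\,{}_1F_1\left(-2k;\frac32;2\alpha x^2\right)dx\\ &=\beta^{-1/4}\,{}_2F_1\left(-2k,1;\frac32;2\right)+4\beta^{3/4}\int_{0}^{\infty}\frac{xe^{-\beta x^2}}{e^{2\pi x}-1}\,{}_1F_1\left(-2k;\frac32;2\beta x^2\right)dx. \end{align*}
   Context: ${}_2F_1$ is the Gauss hypergeometric function (here terminating) and ${}_1F_1$ is Kummer's confluent hypergeometric function. *)

theory Defs
  imports "HOL-Analysis.Analysis"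
begin

(* The n-th coefficient of fps_hypergeo as bs 1 is (a1)_n (a2)_n ... / ((b1)_n (b2)_n ... n!),
   with (a)_n the rising factorial pochhammer a n.  For hyp2F1 the sum of the series is the
   Gauss function when |z| < 1, and for every z when a or b is a non-positive integer and the
   series terminates; no analytic continuation is provided for the remaining arguments. *)

definition hyp2F1 :: "real \<Rightarrow> real \<Rightarrow> real \<Rightarrow> real \<Rightarrow> real" where
  "hyp2F1 a b c z = eval_fps (fps_hypergeo [a, b] [c] 1) z"

definition hyp1F1 :: "real \<Rightarrow> real \<Rightarrow> real \<Rightarrow> real" where
  "hyp1F1 a c z = eval_fps (fps_hypergeo [a] [c] 1) z"

end

(* The function x exp(-a x^2) 1F1(-n; 3/2; 2 a x^2) is an odd Hermite function, so its sine transform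
   is (-1)^n times a multiple of the same function with a replaced by b = pi^2/a.  Write
   1/(exp(2 pi x) - 1) as the sum over m of exp(-2 pi m x), insert this sine transform and integrate
   over x first: the exponentials become multiples of y/(m^2 + y^2), whose sum over m is again
   1/(exp(2 pi y) - 1), up to the correction terms 1/2 and -1/(2 pi y).  The corrections contribute
   the moments 2F1(-n, 1; 3/2; 2) and 2F1(-n, 1/2; 3/2; 2), which agree for even n. *)

theory Submission
  imports Defs "HOL-Probability.Characteristic_Functions"
begin

subsection \<open>Terminating hypergeometric sums\<close>

text \<open>The sine transform works by an argument doubling. Sine moments of the Gaussian only
  produce 1F1(-j; 3/2; z) at z = w^2/(4a); summing these with the weights (n choose j) (-2)^j gives
  (-1)^n 1F1(-n; 3/2; 2z), because 1 + (-2) = -1. This is where the 2 in the argument 2 a x^2 comes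
  from. The obstacle is the exchange of limits: 1/(exp(2 pi x) - 1) has a non-integrable pole at 0,
  so after inserting the sine transform the bound |sin| <= 1 gives no integrable majorant. Fubini is
  therefore applied to one exponential at a time, and both sums over m are handled outside the
  double integral, where the Hermite function, which vanishes at 0, controls the pole. After
  multiplication by 4 \<alpha>^(3/4) the correction 1/2 yields \<alpha>^(-1/4) and the correction
  -1/(2 pi y) yields -\<beta>^(-1/4), each times the common moment: these are the terms outside the
  integrals in the theorem. Evenness of n also removes the sign of the sine transform.\<close>

lemma pochhammer_neg_nat: "pochhammer (- real n) i = (-1) ^ i * fact i * real (n choose i)"
  using gbinomial_pochhammer[of "real n" i]
  by (simp add: binomial_gbinomial power_mult_distrib [symmetric] mult.assoc [symmetric]
        flip: power_mult_distrib)

lemma eval_fps_finite_support: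
  fixes F :: "real fps"
  assumes "\<And>i. i > n \<Longrightarrow> fps_nth F i = 0"
  shows "eval_fps F z = (\<Sum>i\<le>n. fps_nth F i * z ^ i)"
  unfolding eval_fps_def by (intro suminf_finite) (use assms in auto)

lemma hyp1F1_neg_nat:
  "hyp1F1 (- real n) c z = (\<Sum>i\<le>n. (-1) ^ i * real (n choose i) * z ^ i / pochhammer c i)"
  unfolding hyp1F1_def
  by (subst eval_fps_finite_support[where n = n]) (auto simp: pochhammer_neg_nat intro!: sum.cong)

lemma hyp2F1_neg_nat:
  "hyp2F1 (- real n) b c z =
     (\<Sum>i\<le>n. (-1) ^ i * real (n choose i) * pochhammer b i * z ^ i / pochhammer c i)"
  unfolding hyp2F1_def
  by (subst eval_fps_finite_support[where n = n]) (auto simp: pochhammer_neg_nat intro!: sum.cong)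

lemma hyp1F1_0: "hyp1F1 a c 0 = 1"
  by (simp add: hyp1F1_def eval_fps_at_0)

text \<open>Binomials vanish beyond the degree, so the range can be padded; polynomials of different
  degrees then combine termwise under one common range.\<close>

lemma hyp1F1_neg_nat_le:
  assumes "n \<le> N"
  shows "hyp1F1 (- real n) c z = (\<Sum>i\<le>N. (-1) ^ i * real (n choose i) * z ^ i / pochhammer c i)"
  unfolding hyp1F1_neg_nat by (rule sum.mono_neutral_left) (use assms in auto)

lemma pochhammer_half_ratio:
  "pochhammer (3/2 :: real) i = (2 * real i + 1) * pochhammer (1/2) i"
  by (induction i) (auto simp: pochhammer_Suc field_simps)

lemma pochhammer_half_pos: "pochhammer (1/2 :: real) i > 0" "pochhammer (3/2 :: real) i > 0"
  by (simp_all add: pochhammer_pos)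

text \<open>Compare coefficients: since (3/2)_i = (2i+1) (1/2)_i, the claim is absorption (j+1-i)
  C(j+1,i) = (j+1) C(j,i) in disguise. This relation and the next one match the two
  integration-by-parts recursions for the Gaussian moments.\<close>

lemma hyp1F1_contiguous_odd:
  "(2 * real (Suc j) + 1) * hyp1F1 (- real (Suc j)) (3/2) z =
     2 * real (Suc j) * hyp1F1 (- real j) (3/2) z + hyp1F1 (- real (Suc j)) (1/2) z"
proof -
  have coeff: "(2 * real (Suc j) + 1) * (x * real (Suc j choose i) * y / pochhammer (3/2) i)
      = 2 * real (Suc j) * (x * real (j choose i) * y / pochhammer (3/2) i)
        + x * real (Suc j choose i) * y / pochhammer (1/2) i"
    if "i \<le> Suc j" for x y :: real and i
  proof -
    have "(Suc j - i) * (Suc j choose i) = Suc j * (j choose i)"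
      using binomial_absorb_comp[of "Suc j" i] by simp
    then have "real ((Suc j - i) * (Suc j choose i)) = real (Suc j * (j choose i))"
      by (rule arg_cong)
    then have "(real (Suc j) - real i) * real (Suc j choose i) = real (Suc j) * real (j choose i)"
      using that by (simp only: of_nat_mult of_nat_diff)
    then have "(2 * real (Suc j) + 1) * real (Suc j choose i)
        = 2 * real (Suc j) * real (j choose i) + (2 * real i + 1) * real (Suc j choose i)"
      by (simp only: algebra_simps)
    then have key: "((2 * real (Suc j) + 1) * real (Suc j choose i)) * (x * y / pochhammer (3/2) i)
        = (2 * real (Suc j) * real (j choose i) + (2 * real i + 1) * real (Suc j choose i))
          * (x * y / pochhammer (3/2) i)"
      by (simp only:)
    have "1 / pochhammer (1/2 :: real) i = (2 * real i + 1) / pochhammer (3/2) i"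
      by (simp add: pochhammer_half_ratio divide_simps add_nonneg_eq_0_iff)
    then have "x * real (Suc j choose i) * y * (1 / pochhammer (1/2) i) =
        x * real (Suc j choose i) * y * ((2 * real i + 1) / pochhammer (3/2) i)"
      by (simp only:)
    with key show ?thesis
      by (simp only: distrib_right times_divide_eq_right times_divide_eq_left mult_1_right mult_1 add_divide_distrib distrib_left mult_ac)
  qed
  show ?thesis
    unfolding hyp1F1_neg_nat[of "Suc j"] hyp1F1_neg_nat_le[of j "Suc j" "3/2", OF le_SucI[OF le_refl]]
      sum_distrib_left sum.distrib [symmetric]
    by (intro sum.cong refl coeff) auto
qed

text \<open>Pascal's rule leaves C(j,i-1) in the difference of the two polynomials; after an index
  shift, (1/2)_(i+1) = (1/2) (3/2)_i raises the lower parameter and produces the factor 2z.\<close>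

lemma hyp1F1_contiguous_even:
  "hyp1F1 (- real (Suc j)) (1/2) z = hyp1F1 (- real j) (1/2) z - 2 * z * hyp1F1 (- real j) (3/2) z"
proof -
  have "hyp1F1 (- real (Suc j)) (1/2) z - hyp1F1 (- real j) (1/2) z =
      (\<Sum>i\<le>Suc j. (-1) ^ i * (real (Suc j choose i) - real (j choose i)) * z ^ i / pochhammer (1/2) i)"
    unfolding hyp1F1_neg_nat[of "Suc j"] hyp1F1_neg_nat_le[of j "Suc j" "1/2", OF le_SucI[OF le_refl]]
      sum_subtractf [symmetric]
    by (intro sum.cong refl) (simp add: algebra_simps diff_divide_distrib)
  also have "\<dots> = (\<Sum>i\<le>j. (-1) ^ Suc i * real (j choose i) * z ^ Suc i / pochhammer (1/2) (Suc i))"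
    by (subst sum.atMost_Suc_shift) simp
  also have "\<dots> = - 2 * z * hyp1F1 (- real j) (3/2) z"
    unfolding hyp1F1_neg_nat sum_distrib_left
    by (intro sum.cong refl) (simp add: pochhammer_rec)
  finally show ?thesis by simp
qed

text \<open>Trinomial revision C(n,j) C(j,i) = C(n,i) C(n-i,j-i) pulls \<open>n choose i\<close>
  out, and the binomial theorem sums the rest.\<close>

lemma sum_binomial_mult_binomial:
  "(\<Sum>j\<le>n. real (n choose j) * real (j choose i) * x ^ j) = real (n choose i) * x ^ i * (1 + x) ^ (n - i)"
proof (cases "i \<le> n")
  case True
  have "(\<Sum>j\<le>n. real (n choose j) * real (j choose i) * x ^ j) =
      (\<Sum>j=i..n. real (n choose j) * real (j choose i) * x ^ j)"
    by (rule sum.mono_neutral_right) auto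
  also have "\<dots> = (\<Sum>j=i..n. real (n choose i) * real ((n - i) choose (j - i)) * x ^ j)"
    by (intro sum.cong refl) (simp add: choose_mult flip: of_nat_mult)
  also have "\<dots> = (\<Sum>j\<le>n-i. real (n choose i) * real ((n - i) choose j) * x ^ (j + i))"
    by (rule sum.reindex_bij_witness[of _ "\<lambda>j. j + i" "\<lambda>j. j - i"]) (use True in auto)
  also have "\<dots> = real (n choose i) * x ^ i * (\<Sum>j\<le>n-i. real ((n - i) choose j) * x ^ j * 1 ^ (n - i - j))"
    by (simp add: sum_distrib_left power_add mult_ac)
  also have "\<dots> = real (n choose i) * x ^ i * (1 + x) ^ (n - i)"
    by (subst binomial_ring [symmetric]) (simp add: add.commute)
  finally show ?thesis .
next
  case False
  then have "(\<Sum>j\<le>n. real (n choose j) * real (j choose i) * x ^ j) = 0"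
    by (intro sum.neutral) auto
  with False show ?thesis by simp
qed

text \<open>The argument doubling. After swapping the sums, the inner one is the previous lemma at x
  = -2, where 1 + x = -1 contributes only a sign and x^i contributes the 2^i that is absorbed into
  the argument.\<close>

lemma sum_binomial_hyp1F1:
  "(\<Sum>j\<le>n. real (n choose j) * (-2) ^ j * hyp1F1 (- real j) c z) = (-1) ^ n * hyp1F1 (- real n) c (2 * z)"
proof -
  have "(\<Sum>j\<le>n. real (n choose j) * (-2) ^ j * hyp1F1 (- real j) c z) =
      (\<Sum>j\<le>n. \<Sum>i\<le>n. real (n choose j) * (-2) ^ j * ((-1) ^ i * real (j choose i) * z ^ i / pochhammer c i))"
    by (simp add: hyp1F1_neg_nat_le[of _ n] sum_distrib_left)
  also have "\<dots> = (\<Sum>i\<le>n. (\<Sum>j\<le>n. real (n choose j) * real (j choose i) * (-2) ^ j) *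
      ((-1) ^ i * z ^ i / pochhammer c i))"
    unfolding sum_distrib_right by (subst sum.swap) (simp add: mult_ac)
  also have "\<dots> = (\<Sum>i\<le>n. (-1) ^ n * ((-1) ^ i * real (n choose i) * (2 * z) ^ i / pochhammer c i))"
  proof (intro sum.cong refl)
    fix i assume "i \<in> {..n}"
    then have "(-1 :: real) ^ (n - i) = (-1) ^ n * (-1) ^ i"
      by (simp add: minus_one_power_iff)
    then show "(\<Sum>j\<le>n. real (n choose j) * real (j choose i) * (-2) ^ j) * ((-1) ^ i * z ^ i / pochhammer c i)
        = (-1) ^ n * ((-1) ^ i * real (n choose i) * (2 * z) ^ i / pochhammer c i)"
      unfolding sum_binomial_mult_binomial
      by (simp add: power_mult_distrib power_minus[of "2::real"] mult_ac)
  qed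
  finally show ?thesis by (simp add: hyp1F1_neg_nat sum_distrib_left)
qed

text \<open>The function u (1 - u^2)^(j+1) vanishes at both ends. Writing u^2 = 1 - (1 - u^2) in its
  derivative gives the recursion (2j+3) I_(j+1) = 2(j+1) I_j, which is the step of the quotient
  j!/(3/2)_j.\<close>

lemma integral_one_minus_square_power:
  "((\<lambda>u::real. (1 - u\<^sup>2) ^ j) has_integral (fact j / pochhammer (3/2) j)) {0..1}"
proof (induction j)
  case 0
  show ?case using has_integral_const_real[of "1::real" 0 1] by simp
next
  case (Suc j)
  have "((\<lambda>u::real. u * (1 - u\<^sup>2) ^ Suc j) has_field_derivative
      (2 * real j + 3) * (1 - u\<^sup>2) ^ Suc j - 2 * (real j + 1) * (1 - u\<^sup>2) ^ j) (at u within {0..1})" for u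
  proof -
    have "((\<lambda>u::real. u * (1 - u\<^sup>2) ^ Suc j) has_field_derivative
        1 * (1 - u\<^sup>2) ^ Suc j + real (Suc j) * (1 - u\<^sup>2) ^ j * (0 - 2 * u) * u) (at u within {0..1})"
      by (rule derivative_eq_intros refl | simp del: power_Suc)+
    then show ?thesis by (simp add: algebra_simps power2_eq_square)
  qed
  then have "((\<lambda>u. (2 * real j + 3) * (1 - u\<^sup>2) ^ Suc j - 2 * (real j + 1) * (1 - u\<^sup>2) ^ j) has_integral
      (1 * (1 - 1\<^sup>2) ^ Suc j - 0 * (1 - 0\<^sup>2) ^ Suc j)) {0..1::real}"
    by (intro fundamental_theorem_of_calculus)
       (auto simp: has_real_derivative_iff_has_vector_derivative)
  then have "((\<lambda>u. (2 * real j + 3) * (1 - u\<^sup>2) ^ Suc j - 2 * (real j + 1) * (1 - u\<^sup>2) ^ j) has_integral 0) {0..1::real}"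
    by simp
  from has_integral_add[OF this has_integral_mult_right[OF Suc.IH, of "2 * (real j + 1)"]]
  have "((\<lambda>u. (2 * real j + 3) * (1 - u\<^sup>2) ^ Suc j) has_integral
     (2 * (real j + 1) * (fact j / pochhammer (3/2) j))) {0..1::real}"
    by simp
  from has_integral_mult_right[OF this, of "1 / (2 * real j + 3)"]
  have "((\<lambda>u. (1 - u\<^sup>2) ^ Suc j) has_integral
     (1 / (2 * real j + 3) * (2 * (real j + 1) * (fact j / pochhammer (3/2) j)))) {0..1::real}"
    by (simp del: power_Suc)
  moreover have "1 / (2 * real j + 3) * (2 * (real j + 1) * (fact j / pochhammer (3/2) j)) =
      fact (Suc j) / pochhammer (3/2) (Suc j)"
    using pochhammer_half_pos(2)[of j] by (simp add: pochhammer_Suc divide_simps) (simp add: algebra_simps)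
  ultimately show ?case by simp
qed

(* Up to the sign, both sides are the integral of (1 - 2 t^2)^n over [0,1], expanded in powers
   of 1 - t^2 and of t^2 respectively. *)
lemma hyp2F1_pfaff_at_2:
  "hyp2F1 (- real n) 1 (3/2) 2 = (-1) ^ n * hyp2F1 (- real n) (1/2) (3/2) 2"
proof -
  have "((\<lambda>t::real. \<Sum>i\<le>n. real (n choose i) * (-2) ^ i * (1 - t\<^sup>2) ^ i) has_integral
      (\<Sum>i\<le>n. real (n choose i) * (-2) ^ i * (fact i / pochhammer (3/2) i))) {0..1}"
    by (intro has_integral_sum has_integral_mult_right integral_one_minus_square_power) auto
  moreover have "(\<Sum>i\<le>n. real (n choose i) * (-2) ^ i * (1 - t\<^sup>2) ^ i) = (-1) ^ n * (1 - 2 * t\<^sup>2) ^ n"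
    for t :: real
  proof -
    have "(\<Sum>i\<le>n. real (n choose i) * (-2) ^ i * (1 - t\<^sup>2) ^ i) = ((-2) * (1 - t\<^sup>2) + 1) ^ n"
      by (subst binomial_ring) (simp only: power_mult_distrib power_one mult_1_right mult.assoc)
    also have "(-2) * (1 - t\<^sup>2) + 1 = (-1) * (1 - 2 * t\<^sup>2)" by simp
    finally show ?thesis by (simp only: power_mult_distrib)
  qed
  moreover have "(\<Sum>i\<le>n. real (n choose i) * (-2) ^ i * (fact i / pochhammer (3/2) i)) =
      hyp2F1 (- real n) 1 (3/2) 2"
    unfolding hyp2F1_neg_nat
    by (intro sum.cong refl) (simp add: pochhammer_fact [symmetric] power_minus[of "2::real"] mult_ac)
  ultimately have "((\<lambda>t::real. (-1) ^ n * (1 - 2 * t\<^sup>2) ^ n) has_integral hyp2F1 (- real n) 1 (3/2) 2) {0..1}"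
    by simp
  moreover have "((\<lambda>t::real. (-1) ^ n * (1 - 2 * t\<^sup>2) ^ n) has_integral
      (-1) ^ n * hyp2F1 (- real n) (1/2) (3/2) 2) {0..1}"
  proof (rule has_integral_mult_right)
    have pow: "((\<lambda>t::real. (t\<^sup>2) ^ i) has_integral (1 / (2 * real i + 1))) {0..1}" for i
    proof -
      have "((\<lambda>t::real. t ^ (2 * i + 1) / (2 * real i + 1)) has_field_derivative (t\<^sup>2) ^ i) (at t within {0..1})" for t
      proof -
        have "((\<lambda>t::real. t ^ (2 * i + 1) / (2 * real i + 1)) has_field_derivative
            real (2 * i + 1) * t ^ (2 * i) / (2 * real i + 1)) (at t within {0..1})"
          by (rule derivative_eq_intros refl | simp)+
        moreover have "real (2 * i + 1) * t ^ (2 * i) / (2 * real i + 1) = (t\<^sup>2) ^ i"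
          by (simp add: power_mult divide_simps add_nonneg_eq_0_iff)
        ultimately show ?thesis by simp
      qed
      then have "((\<lambda>t::real. (t\<^sup>2) ^ i) has_integral (1 ^ (2 * i + 1) / (2 * real i + 1) - 0 ^ (2 * i + 1) / (2 * real i + 1))) {0..1}"
        by (intro fundamental_theorem_of_calculus)
           (auto simp: has_real_derivative_iff_has_vector_derivative)
      then show ?thesis by simp
    qed
    have "((\<lambda>t::real. \<Sum>i\<le>n. real (n choose i) * (-2) ^ i * (t\<^sup>2) ^ i) has_integral
      (\<Sum>i\<le>n. real (n choose i) * (-2) ^ i * (1 / (2 * real i + 1)))) {0..1}"
      by (intro has_integral_sum has_integral_mult_right pow) auto
    moreover have "(\<Sum>i\<le>n. real (n choose i) * (-2) ^ i * (t\<^sup>2) ^ i) = (1 - 2 * t\<^sup>2) ^ n" for t :: real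
    proof -
      have "(\<Sum>i\<le>n. real (n choose i) * (-2) ^ i * (t\<^sup>2) ^ i) = ((-2) * t\<^sup>2 + 1) ^ n"
        by (subst binomial_ring) (simp only: power_mult_distrib power_one mult_1_right mult.assoc)
      also have "(-2) * t\<^sup>2 + 1 = 1 - 2 * t\<^sup>2" by simp
      finally show ?thesis .
    qed
    moreover have "(\<Sum>i\<le>n. real (n choose i) * (-2) ^ i * (1 / (2 * real i + 1))) =
        hyp2F1 (- real n) (1/2) (3/2) 2"
      unfolding hyp2F1_neg_nat
    proof (intro sum.cong refl)
      fix i
      have "pochhammer (1/2) i / pochhammer (3/2) i = 1 / (2 * real i + 1)"
        using pochhammer_half_pos(1)[of i] by (simp add: pochhammer_half_ratio)
      then show "real (n choose i) * (-2) ^ i * (1 / (2 * real i + 1)) =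
          (-1) ^ i * real (n choose i) * pochhammer (1/2) i * 2 ^ i / pochhammer (3/2) i"
        by (simp add: power_minus[of "2::real"] mult_ac flip: times_divide_eq_right)
    qed
    ultimately show "((\<lambda>t::real. (1 - 2 * t\<^sup>2) ^ n) has_integral hyp2F1 (- real n) (1/2) (3/2) 2) {0..1}"
      by simp
  qed
  ultimately show ?thesis by (rule has_integral_unique)
qed

subsection \<open>Partial fractions of the Planck kernel\<close>

text \<open>Euler's sine product at the imaginary point \<open>\<i> * x\<close>: all partial
  products and the limit are \<open>\<i>\<close> times a real number, so imaginary parts carry the
  whole statement.\<close>

lemma sinh_product_formula_real:
  "(\<lambda>n. pi * x * (\<Prod>k=1..n. 1 + x\<^sup>2 / real k ^ 2)) \<longlonglongrightarrow> sinh (pi * x)"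
proof -
  have "(\<lambda>n. of_real pi * (\<i> * of_real x) * (\<Prod>k=1..n. 1 - (\<i> * of_real x)\<^sup>2 / of_nat k ^ 2))
      \<longlonglongrightarrow> sin (of_real pi * (\<i> * of_real x))"
    by (rule sin_product_formula_complex)
  also have "(\<lambda>n. of_real pi * (\<i> * of_real x) * (\<Prod>k=1..n. 1 - (\<i> * of_real x)\<^sup>2 / of_nat k ^ 2)) =
      (\<lambda>n. \<i> * of_real (pi * x * (\<Prod>k=1..n. 1 + x\<^sup>2 / real k ^ 2)))"
    by (simp add: power_mult_distrib mult_ac)
  also have "sin (of_real pi * (\<i> * of_real x)) = \<i> * of_real (sinh (pi * x))"
  proof -
    have "sin (of_real pi * (\<i> * of_real x)) = sin (\<i> * complex_of_real (pi * x))"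
      by (simp add: mult_ac)
    also have "\<dots> = \<i> * of_real (sinh (pi * x))"
      unfolding sin_i_times by (simp add: sinh_field_def exp_minus flip: exp_of_real)
    finally show ?thesis .
  qed
  finally have "(\<lambda>n. Im (\<i> * of_real (pi * x * (\<Prod>k=1..n. 1 + x\<^sup>2 / real k ^ 2)))) \<longlonglongrightarrow>
      Im (\<i> * of_real (sinh (pi * x)))"
    by (rule tendsto_Im)
  then show ?thesis by (simp only: Im_i_times Re_complex_of_real)
qed

lemma ln_sinh_series:
  assumes "x > (0 :: real)"
  shows "(\<lambda>k. ln (1 + x\<^sup>2 / real (Suc k) ^ 2)) sums (ln (sinh (pi * x)) - ln (pi * x))"
proof -
  have sinh_pos: "sinh (pi * x) > 0" using assms by simp
  have "(\<lambda>n. ln (pi * x * (\<Prod>k=1..n. 1 + x\<^sup>2 / real k ^ 2)) - ln (pi * x)) \<longlonglongrightarrow> ln (sinh (pi * x)) - ln (pi * x)"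
    using sinh_pos by (intro tendsto_intros sinh_product_formula_real) auto
  also have "(\<lambda>n. ln (pi * x * (\<Prod>k=1..n. 1 + x\<^sup>2 / real k ^ 2)) - ln (pi * x)) =
      (\<lambda>n. \<Sum>k<n. ln (1 + x\<^sup>2 / real (Suc k) ^ 2))"
  proof
    fix n
    have pos: "1 + x\<^sup>2 / real k ^ 2 > 0" for k
      by (intro add_pos_nonneg) auto
    have "ln (pi * x * (\<Prod>k=1..n. 1 + x\<^sup>2 / real k ^ 2)) = ln (pi * x) + ln (\<Prod>k=1..n. 1 + x\<^sup>2 / real k ^ 2)"
      using assms pos by (intro ln_mult_pos prod_pos) auto
    also have "ln (\<Prod>k=1..n. 1 + x\<^sup>2 / real k ^ 2) = (\<Sum>k=1..n. ln (1 + x\<^sup>2 / real k ^ 2))"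
      using pos by (intro ln_prod) (auto simp: less_imp_neq[symmetric])
    also have "\<dots> = (\<Sum>k<n. ln (1 + x\<^sup>2 / real (Suc k) ^ 2))"
      by (rule sum.reindex_bij_witness[of _ Suc "\<lambda>k. k - 1"]) auto
    finally show "ln (pi * x * (\<Prod>k=1..n. 1 + x\<^sup>2 / real k ^ 2)) - ln (pi * x) =
        (\<Sum>k<n. ln (1 + x\<^sup>2 / real (Suc k) ^ 2))"
      by simp
  qed
  finally show ?thesis by (simp add: sums_def)
qed

text \<open>This is the logarithmic derivative of the product for sinh, obtained by differentiating
  the series of logarithms term by term.\<close>

lemma coth_partial_fractions:
  assumes "x > (0 :: real)"
  shows "(\<lambda>k. 2 * x / (real (Suc k) ^ 2 + x\<^sup>2)) sums (pi * cosh (pi * x) / sinh (pi * x) - 1 / x)"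
proof -
  \<comment> \<open>Some upper bound on y is needed for the majorant 2(x+1)/k^2 of the derivatives;
    the value x + 1 only has to keep x in the interior.\<close>
  define S where "S = {0<..<x + 1}"
  have inv_sq: "summable (\<lambda>k. 1 / real (Suc k) ^ 2)"
    using inverse_squares_sums by (simp add: sums_iff add.commute)
  have bound: "norm (2 * y / (real (Suc k) ^ 2 + y\<^sup>2)) \<le> 2 * (x + 1) * (1 / real (Suc k) ^ 2)" if "y \<in> S" for y k
  proof -
    have "2 * y / (real (Suc k) ^ 2 + y\<^sup>2) \<le> 2 * (x + 1) / real (Suc k) ^ 2"
      using that assms by (intro frac_le) (auto simp: S_def simp del: of_nat_Suc)
    then show ?thesis using that by (simp add: S_def del: of_nat_Suc)
  qed
  have deriv: "((\<lambda>y. \<Sum>k. ln (1 + y\<^sup>2 / real (Suc k) ^ 2)) has_field_derivative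
      (\<Sum>k. 2 * x / (real (Suc k) ^ 2 + x\<^sup>2))) (at x)"
  proof (rule has_field_derivative_series'(2)[where S = S and x0 = x])
    show "convex S" by (simp add: S_def)
    show "((\<lambda>y. ln (1 + y\<^sup>2 / real (Suc k) ^ 2)) has_field_derivative 2 * y / (real (Suc k) ^ 2 + y\<^sup>2)) (at y within S)"
      if "y \<in> S" for k y
    proof -
      have pos: "1 + y\<^sup>2 / real (Suc k) ^ 2 > 0" by (intro add_pos_nonneg) auto
      have "((\<lambda>y. ln (1 + y\<^sup>2 / real (Suc k) ^ 2)) has_field_derivative
          1 / (1 + y\<^sup>2 / real (Suc k) ^ 2) * (2 * y / real (Suc k) ^ 2)) (at y within S)"
      proof -
        have "((\<lambda>y. 1 + y\<^sup>2 / real (Suc k) ^ 2) has_field_derivative 2 * y / real (Suc k) ^ 2) (at y within S)"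
          by (rule derivative_eq_intros refl | simp add: power2_eq_square del: of_nat_Suc)+
        then show ?thesis by (rule DERIV_chain2[where f = ln and g = "\<lambda>y. 1 + y\<^sup>2 / real (Suc k) ^ 2", OF DERIV_ln_divide[OF pos]])
      qed
      also have "1 / (1 + y\<^sup>2 / real (Suc k) ^ 2) * (2 * y / real (Suc k) ^ 2) = 2 * y / (real (Suc k) ^ 2 + y\<^sup>2)"
      proof -
        have "(1 + y\<^sup>2 / real (Suc k) ^ 2) * real (Suc k) ^ 2 = real (Suc k) ^ 2 + y\<^sup>2"
          by (simp add: distrib_right del: of_nat_Suc)
        then show ?thesis by (simp only: times_divide_times_eq mult_1)
      qed
      finally show ?thesis .
    qed
    show "uniformly_convergent_on S (\<lambda>n y. \<Sum>k<n. 2 * y / (real (Suc k) ^ 2 + y\<^sup>2))"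
      by (rule Weierstrass_m_test'[where M = "\<lambda>k. 2 * (x + 1) * (1 / real (Suc k) ^ 2)"])
         (use bound inv_sq summable_mult in blast)+
    show "x \<in> S" "x \<in> interior S" using assms by (auto simp: S_def)
    show "summable (\<lambda>k. ln (1 + x\<^sup>2 / real (Suc k) ^ 2))"
      using ln_sinh_series[OF assms] by (simp add: sums_iff)
  qed
  \<comment> \<open>The closed form of the series is known for positive arguments only, so the
    derivative is transferred on the open half-line and then compared with the directly computed
    one.\<close>
  have "((\<lambda>y. ln (sinh (pi * y)) - ln (pi * y)) has_field_derivative
      (\<Sum>k. 2 * x / (real (Suc k) ^ 2 + x\<^sup>2))) (at x)"
    by (rule has_field_derivative_transform_within_open[OF deriv, of "{0<..}"])
       (use assms ln_sinh_series in \<open>auto simp: sums_iff\<close>)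
  moreover have "((\<lambda>y. ln (sinh (pi * y)) - ln (pi * y)) has_field_derivative
      (pi * cosh (pi * x) / sinh (pi * x) - 1 / x)) (at x)"
    using assms by (auto intro!: derivative_eq_intros simp: field_simps)
  ultimately have "(\<Sum>k. 2 * x / (real (Suc k) ^ 2 + x\<^sup>2)) = pi * cosh (pi * x) / sinh (pi * x) - 1 / x"
    by (rule DERIV_unique)
  moreover have "summable (\<lambda>k. 2 * x / (real (Suc k) ^ 2 + x\<^sup>2))"
  proof (rule summable_comparison_test')
    show "summable (\<lambda>k. 2 * (x + 1) * (1 / real (Suc k) ^ 2))"
      by (intro summable_mult inv_sq)
    show "norm (2 * x / (real (Suc k) ^ 2 + x\<^sup>2)) \<le> 2 * (x + 1) * (1 / real (Suc k) ^ 2)" if "k \<ge> 0" for k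
      by (rule bound) (use assms in \<open>simp add: S_def\<close>)
  qed
  ultimately show ?thesis by (simp add: sums_iff)
qed

text \<open>Insert coth(pi x) = 1 + 2/(exp(2 pi x) - 1) and divide by 2 pi: the summand 1 becomes
  the correction 1/2, and the pole term 1/x becomes 1/(2 pi x).\<close>

lemma planck_partial_fractions:
  assumes "x > (0 :: real)"
  shows "(\<lambda>k. x / (pi * (real (Suc k) ^ 2 + x\<^sup>2))) sums
           (1 / (exp (2 * pi * x) - 1) - 1 / (2 * pi * x) + 1 / 2)"
proof -
  have "exp (pi * x) > 1" "exp (pi * x) > 0" using assms by simp_all
  then have ne: "exp (pi * x) ^ 2 \<noteq> 1" "exp (pi * x) \<noteq> 0"
    unfolding power2_eq_1_iff by linarith+
  have "exp (2 * pi * x) = exp (pi * x) ^ 2"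
    by (simp add: exp_double [symmetric] mult.assoc)
  moreover have "cosh (pi * x) / sinh (pi * x) = (exp (pi * x) ^ 2 + 1) / (exp (pi * x) ^ 2 - 1)"
    using ne by (simp add: cosh_def sinh_def exp_minus power2_eq_square field_simps)
  ultimately have coth: "cosh (pi * x) / sinh (pi * x) = 2 / (exp (2 * pi * x) - 1) + 1"
    using ne by (simp add: field_simps)
  have "(\<lambda>k. 2 * x / (real (Suc k) ^ 2 + x\<^sup>2) / (2 * pi)) sums
      ((pi * (cosh (pi * x) / sinh (pi * x)) - 1 / x) / (2 * pi))"
    using coth_partial_fractions[OF assms] by (intro sums_divide) (simp add: mult.assoc)
  also have "(pi * (cosh (pi * x) / sinh (pi * x)) - 1 / x) / (2 * pi) =
      1 / (exp (2 * pi * x) - 1) - 1 / (2 * pi * x) + 1 / 2"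
    unfolding coth using ne \<open>exp (2 * pi * x) = exp (pi * x) ^ 2\<close> assms
    by (simp add: divide_simps) (simp add: algebra_simps)
  also have "(\<lambda>k. 2 * x / (real (Suc k) ^ 2 + x\<^sup>2) / (2 * pi)) = (\<lambda>k. x / (pi * (real (Suc k) ^ 2 + x\<^sup>2)))"
    by (simp add: mult.commute mult.left_commute divide_divide_eq_left mult_divide_mult_cancel_left del: of_nat_Suc distrib_left_numeral)
  finally show ?thesis .
qed

subsection \<open>Trigonometric moments of the Gaussian\<close>

lemma einterval_0_infinity: "einterval 0 \<infinity> = {0<..}"
  by (auto simp: einterval_def)

lemma set_integral_FTC_Ioi:
  fixes f F :: "real \<Rightarrow> real"
  assumes deriv: "\<And>x. (F has_field_derivative f x) (at x)"
    and cont: "continuous_on UNIV f"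
    and integrable: "set_integrable lborel {0<..} f"
    and lim: "(F \<longlongrightarrow> L) at_top"
  shows "(LBINT x:{0<..}. f x) = L - F 0"
proof -
  have contF: "isCont F 0" using deriv by (rule DERIV_isCont)
  have "(LBINT x=0..\<infinity>. f x) = L - F 0"
  proof (rule interval_integral_FTC_integrable[of 0 \<infinity> F f])
    show "(F has_vector_derivative f x) (at x)" for x
      using deriv by (simp add: has_real_derivative_iff_has_vector_derivative)
    show "isCont f x" for x using cont by (simp add: continuous_on_eq_continuous_at)
    show "set_integrable lborel (einterval 0 \<infinity>) f" using integrable by (simp add: einterval_0_infinity)
    show "((F \<circ> real_of_ereal) \<longlongrightarrow> F 0) (at_right 0)"
      using contF unfolding zero_ereal_def isCont_def
      by (simp add: ereal_tendsto_simps) (rule filterlim_at_split[THEN iffD1, THEN conjunct2])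
    show "((F \<circ> real_of_ereal) \<longlongrightarrow> L) (at_left \<infinity>)"
      using lim by (simp add: ereal_tendsto_simps)
  qed simp
  then show ?thesis by (simp add: interval_lebesgue_integral_0_infty)
qed

lemma set_borel_measurable_Ioi [measurable (raw)]:
  "f \<in> borel_measurable borel \<Longrightarrow> set_borel_measurable lborel {0::real<..} (f :: real \<Rightarrow> real)"
  unfolding set_borel_measurable_def by measurable

text \<open>The substitution x -> sqrt(a) x reduces to the known moments of exp(-x^2), which come
  separately for even and odd exponents.\<close>

lemma set_integrable_gaussian_moment:
  fixes a :: real
  assumes "a > 0"
  shows "set_integrable lborel {0<..} (\<lambda>x. x ^ k * exp (- a * x\<^sup>2))"
proof -
  have "integrable lborel (\<lambda>x::real. indicator {0..} x *\<^sub>R (exp (- x\<^sup>2) * x ^ k))"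
  proof (cases "even k")
    case True
    then obtain j where "k = 2 * j" by (elim evenE)
    then show ?thesis using gaussian_moment_even_pos[of j] by (simp add: has_bochner_integral_iff)
  next
    case False
    then obtain j where "k = 2 * j + 1" by (elim oddE)
    then show ?thesis using gaussian_moment_odd_pos[of j] by (simp add: has_bochner_integral_iff)
  qed
  from lborel_integrable_real_affine[OF this, of "sqrt a" 0]
  have "integrable lborel (\<lambda>x. indicator {0..} (sqrt a * x) *\<^sub>R (exp (- (sqrt a * x)\<^sup>2) * (sqrt a * x) ^ k))"
    using assms by simp
  also have "(\<lambda>x. indicator {0..} (sqrt a * x) *\<^sub>R (exp (- (sqrt a * x)\<^sup>2) * (sqrt a * x) ^ k)) =
      (\<lambda>x. indicator {0..} x *\<^sub>R (sqrt a ^ k * (x ^ k * exp (- a * x\<^sup>2))))"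
    using assms by (auto simp: fun_eq_iff power_mult_distrib zero_le_mult_iff split: split_indicator)
  finally have "set_integrable lborel {0..} (\<lambda>x. sqrt a ^ k * (x ^ k * exp (- a * x\<^sup>2)))"
    by (simp add: set_integrable_def)
  then have "set_integrable lborel {0..} (\<lambda>x. x ^ k * exp (- a * x\<^sup>2))"
    using assms by (subst (asm) set_integrable_mult_right_iff) auto
  then show ?thesis by (rule set_integrable_subset) auto
qed

lemma set_integrable_mult_bounded:
  fixes f g :: "real \<Rightarrow> real"
  assumes "set_integrable lborel {0<..} f" "f \<in> borel_measurable borel" "g \<in> borel_measurable borel"
    and "\<And>x. x > 0 \<Longrightarrow> \<bar>g x\<bar> \<le> C"
  shows "set_integrable lborel {0<..} (\<lambda>x. f x * g x)"
proof (rule set_integrable_bound)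
  show "set_integrable lborel {0<..} (\<lambda>x. C * f x)" using assms(1) by simp
  show "set_borel_measurable lborel {0<..} (\<lambda>x. f x * g x)" using assms(2,3) by measurable
  have "C \<ge> 0" using assms(4)[of 1] by simp
  show "AE x in lborel. x \<in> {0<..} \<longrightarrow> norm (f x * g x) \<le> norm (C * f x)"
  proof (intro AE_I2 impI)
    fix x :: real assume "x \<in> {0<..}"
    then have "\<bar>f x\<bar> * \<bar>g x\<bar> \<le> \<bar>f x\<bar> * C" by (intro mult_left_mono assms(4)) auto
    then show "norm (f x * g x) \<le> norm (C * f x)"
      using \<open>C \<ge> 0\<close> by (simp add: abs_mult mult.commute)
  qed
qed

text \<open>Integration by parts couples cosine and sine moments, so both families are evaluated
  together. At \<open>w = 0\<close> the cosine family also supplies the plain Gaussian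
  moments.\<close>

definition gauss_cos :: "real \<Rightarrow> real \<Rightarrow> nat \<Rightarrow> real" where
  "gauss_cos a w k = (LBINT x:{0<..}. x ^ k * exp (- a * x\<^sup>2) * cos (w * x))"

definition gauss_sin :: "real \<Rightarrow> real \<Rightarrow> nat \<Rightarrow> real" where
  "gauss_sin a w k = (LBINT x:{0<..}. x ^ k * exp (- a * x\<^sup>2) * sin (w * x))"

lemma set_integrable_gauss_trig:
  fixes a w :: real
  assumes "a > 0"
  shows set_integrable_gauss_cos: "set_integrable lborel {0<..} (\<lambda>x. x ^ k * exp (- a * x\<^sup>2) * cos (w * x))"
    and set_integrable_gauss_sin: "set_integrable lborel {0<..} (\<lambda>x. x ^ k * exp (- a * x\<^sup>2) * sin (w * x))"
  by (rule set_integrable_mult_bounded[where C = 1, OF set_integrable_gaussian_moment[OF assms]]; simp)+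

text \<open>For x >= 1 one has x^k <= (x^2)^k, which reduces the claim to t^k / exp t -> 0 with t =
  a x^2.\<close>

lemma power_times_gaussian_tendsto_0:
  assumes "a > (0 :: real)"
  shows "((\<lambda>x. x ^ k * exp (- a * x\<^sup>2)) \<longlongrightarrow> 0) at_top"
proof (rule tendsto_sandwich[OF _ _ tendsto_const])
  have "filterlim (\<lambda>x::real. a * x\<^sup>2) at_top at_top"
    using assms by (intro filterlim_tendsto_pos_mult_at_top[OF tendsto_const] filterlim_pow_at_top filterlim_ident) auto
  then have "((\<lambda>x. (a * x\<^sup>2) ^ k / exp (a * x\<^sup>2)) \<longlongrightarrow> 0) at_top"
    by (rule filterlim_compose[OF tendsto_power_div_exp_0])
  from tendsto_divide[OF this tendsto_const, of "a ^ k"]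
  show "((\<lambda>x. (a * x\<^sup>2) ^ k / exp (a * x\<^sup>2) / a ^ k) \<longlongrightarrow> 0) at_top"
    using assms by simp
  show "\<forall>\<^sub>F x in at_top. x ^ k * exp (- a * x\<^sup>2) \<le> (a * x\<^sup>2) ^ k / exp (a * x\<^sup>2) / a ^ k"
    using eventually_ge_at_top[of 1]
  proof eventually_elim
    case (elim x)
    have "x ^ k \<le> (x\<^sup>2) ^ k"
      using elim by (intro power_mono) (auto simp: power2_eq_square mult_le_cancel_left1)
    then show ?case
      using assms by (simp add: exp_minus power_mult_distrib divide_simps)
  qed
  show "\<forall>\<^sub>F x in at_top. 0 \<le> x ^ k * exp (- a * x\<^sup>2)"
    using eventually_ge_at_top[of 0] by eventually_elim auto
qed

lemma gauss_trig_tendsto_0: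
  assumes "a > (0 :: real)" "\<And>x. \<bar>g x\<bar> \<le> 1"
  shows "((\<lambda>x. x ^ k * exp (- a * x\<^sup>2) * g x) \<longlongrightarrow> 0) at_top"
proof (rule Lim_null_comparison)
  show "((\<lambda>x. x ^ k * exp (- a * x\<^sup>2)) \<longlongrightarrow> 0) at_top"
    by (rule power_times_gaussian_tendsto_0[OF assms(1)])
  show "\<forall>\<^sub>F x in at_top. norm (x ^ k * exp (- a * x\<^sup>2) * g x) \<le> x ^ k * exp (- a * x\<^sup>2)"
    using eventually_ge_at_top[of 0]
    by eventually_elim (use assms(2) in \<open>auto simp: abs_mult intro!: mult_left_le\<close>)
qed

text \<open>Integrate the derivative of x^k exp(-a x^2) cos(w x). The boundary value at 0 is 1 for k
  = 0 and 0 otherwise, hence \<open>0 ^ k\<close>; the truncated \<open>k - 1\<close> at k = 0 is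
  harmless because its factor \<open>real k\<close> vanishes.\<close>

lemma gauss_cos_rec:
  assumes "a > 0"
  shows "2 * a * gauss_cos a w (Suc k) = real k * gauss_cos a w (k - 1) - w * gauss_sin a w k + 0 ^ k"
proof -
  let ?c = "\<lambda>k x. x ^ k * exp (- a * x\<^sup>2) * cos (w * x)"
  let ?s = "\<lambda>k x. x ^ k * exp (- a * x\<^sup>2) * sin (w * x)"
  have "(LBINT x:{0<..}. real k * ?c (k - 1) x - 2 * a * ?c (Suc k) x - w * ?s k x) = 0 - ?c k 0"
  proof (rule set_integral_FTC_Ioi[where F = "?c k"])
    show "(?c k has_field_derivative real k * ?c (k - 1) x - 2 * a * ?c (Suc k) x - w * ?s k x) (at x)" for x
      by (auto intro!: derivative_eq_intros simp: algebra_simps)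
    show "(?c k \<longlongrightarrow> 0) at_top" by (rule gauss_trig_tendsto_0[OF assms]) simp
    show "set_integrable lborel {0<..} (\<lambda>x. real k * ?c (k - 1) x - 2 * a * ?c (Suc k) x - w * ?s k x)"
      by (intro set_integral_diff(1) set_integrable_mult_right set_integrable_gauss_trig assms)
  qed (auto intro!: continuous_intros)
  also have "(LBINT x:{0<..}. real k * ?c (k - 1) x - 2 * a * ?c (Suc k) x - w * ?s k x) =
      real k * gauss_cos a w (k - 1) - 2 * a * gauss_cos a w (Suc k) - w * gauss_sin a w k"
    unfolding gauss_cos_def gauss_sin_def set_integral_mult_right [symmetric]
    by (subst set_integral_diff(2) [symmetric] |
        intro set_integral_diff(1) set_integrable_mult_right set_integrable_gauss_trig assms)+ simp
  finally show ?thesis by (simp add: power_0_left)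
qed

text \<open>The same integration by parts with sine; here the boundary value at 0 is always
  0.\<close>

lemma gauss_sin_rec:
  assumes "a > 0"
  shows "2 * a * gauss_sin a w (Suc k) = real k * gauss_sin a w (k - 1) + w * gauss_cos a w k"
proof -
  let ?c = "\<lambda>k x. x ^ k * exp (- a * x\<^sup>2) * cos (w * x)"
  let ?s = "\<lambda>k x. x ^ k * exp (- a * x\<^sup>2) * sin (w * x)"
  have "(LBINT x:{0<..}. real k * ?s (k - 1) x - 2 * a * ?s (Suc k) x + w * ?c k x) = 0 - ?s k 0"
  proof (rule set_integral_FTC_Ioi[where F = "?s k"])
    show "(?s k has_field_derivative real k * ?s (k - 1) x - 2 * a * ?s (Suc k) x + w * ?c k x) (at x)" for x
      by (auto intro!: derivative_eq_intros simp: algebra_simps)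
    show "(?s k \<longlongrightarrow> 0) at_top" by (rule gauss_trig_tendsto_0[OF assms]) simp
    show "set_integrable lborel {0<..} (\<lambda>x. real k * ?s (k - 1) x - 2 * a * ?s (Suc k) x + w * ?c k x)"
      by (intro set_integral_diff(1) set_integral_add(1) set_integrable_mult_right set_integrable_gauss_trig assms)
  qed (auto intro!: continuous_intros)
  also have "(LBINT x:{0<..}. real k * ?s (k - 1) x - 2 * a * ?s (Suc k) x + w * ?c k x) =
      real k * gauss_sin a w (k - 1) - 2 * a * gauss_sin a w (Suc k) + w * gauss_cos a w k"
    unfolding gauss_cos_def gauss_sin_def set_integral_mult_right [symmetric]
    by (subst set_integral_diff(2) [symmetric] set_integral_add(2) [symmetric] |
        intro set_integral_diff(1) set_integrable_mult_right set_integrable_gauss_trig assms)+ simp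
  finally show ?thesis by simp
qed

text \<open>This is the real part of the characteristic function of the standard normal
  distribution. The scaling r = sqrt(2a) turns exp(-t^2/2) into exp(-a x^2), and evenness halves the
  integral over the line.\<close>

lemma gauss_cos_0:
  assumes "a > 0"
  shows "gauss_cos a w 0 = sqrt (pi / a) / 2 * exp (- w\<^sup>2 / (4 * a))"
proof -
  define r where "r = sqrt (2 * a)"
  have r: "r > 0" "r\<^sup>2 = 2 * a" using assms by (auto simp: r_def)
  have "exp (- (w / r)\<^sup>2 / 2) = Re (char std_normal_distribution (w / r))"
    by (simp only: char_std_normal_distribution Re_complex_of_real)
  also have "\<dots> = (\<integral>x. cos (w / r * x) \<partial>std_normal_distribution)"
  proof -
    interpret real_distribution std_normal_distribution by (rule real_dist_normal_dist)
    have "integrable std_normal_distribution (\<lambda>x. iexp (w / r * x))"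
      by (rule integrable_iexp) auto
    from integral_Re[OF this] show ?thesis unfolding char_def by (simp add: Re_exp)
  qed
  also have "\<dots> = (\<integral>x. std_normal_density x * cos (w / r * x) \<partial>lborel)"
    by (subst integral_density) auto
  also have "\<dots> = r * (\<integral>x. std_normal_density (0 + r * x) * cos (w / r * (0 + r * x)) \<partial>lborel)"
    using r by (subst lborel_integral_real_affine[where c = r and t = 0]) auto
  also have "(\<lambda>x. std_normal_density (0 + r * x) * cos (w / r * (0 + r * x))) =
      (\<lambda>x. exp (- a * x\<^sup>2) * cos (w * x) / sqrt (2 * pi))"
    using r by (auto simp: fun_eq_iff std_normal_density_def power_mult_distrib)
  finally have full: "exp (- (w / r)\<^sup>2 / 2) = r / sqrt (2 * pi) * (\<integral>x. exp (- a * x\<^sup>2) * cos (w * x) \<partial>lborel)"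
    by simp
  have "has_bochner_integral lborel (\<lambda>x. indicator {0<..} x *\<^sub>R (exp (- a * x\<^sup>2) * cos (w * x))) (gauss_cos a w 0)"
    using set_integrable_gauss_cos[OF assms, of 0 w]
    by (simp add: has_bochner_integral_iff gauss_cos_def set_integrable_def set_lebesgue_integral_def)
  \<comment> \<open>The rule for even functions uses the closed half-line; adding the point 0
    changes a null set.\<close>
  then have "has_bochner_integral lborel (\<lambda>x. indicator {0..} x *\<^sub>R (exp (- a * x\<^sup>2) * cos (w * x))) (gauss_cos a w 0)"
  proof (rule has_bochner_integral_cong_AE[THEN iffD1, rotated -1])
    show "AE x in lborel. indicator {0<..} x *\<^sub>R (exp (- a * x\<^sup>2) * cos (w * x)) = indicator {0..} x *\<^sub>R (exp (- a * x\<^sup>2) * cos (w * x))"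
      using AE_lborel_singleton[of "0::real"] by eventually_elim (auto split: split_indicator)
  qed auto
  from has_bochner_integral_even_function[OF this]
  have "(\<integral>x. exp (- a * x\<^sup>2) * cos (w * x) \<partial>lborel) = 2 * gauss_cos a w 0"
    by (simp add: has_bochner_integral_iff)
  with full have "gauss_cos a w 0 = sqrt (2 * pi) / r / 2 * exp (- (w / r)\<^sup>2 / 2)"
    using r by (simp add: field_simps)
  also have "sqrt (2 * pi) / r = sqrt (pi / a)"
    unfolding r_def by (simp flip: real_sqrt_divide)
  also have "- (w / r)\<^sup>2 / 2 = - w\<^sup>2 / (4 * a)"
    by (simp add: power_divide r)
  finally show ?thesis .
qed

text \<open>A joint induction, since neither family closes on its own: the cosine moment 2j+2 comes
  from the moments 2j and 2j+1 through \<open>hyp1F1_contiguous_even\<close>, then the sine moment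
  2j+3 from 2j+1 and 2j+2 through \<open>hyp1F1_contiguous_odd\<close>.\<close>

lemma gauss_trig_closed_form:
  fixes w :: real
  assumes "a > 0"
  defines "z \<equiv> w\<^sup>2 / (4 * a)"
  shows gauss_cos_even: "gauss_cos a w (2 * j) =
          pochhammer (1/2) j / a ^ j * (sqrt (pi / a) / 2) * exp (- z) * hyp1F1 (- real j) (1/2) z"
    and gauss_sin_odd: "gauss_sin a w (2 * j + 1) =
          pochhammer (3/2) j / a ^ j * (w / (4 * a)) * sqrt (pi / a) * exp (- z) * hyp1F1 (- real j) (3/2) z"
proof (induction j)
  case 0
  show c: "gauss_cos a w (2 * 0) =
          pochhammer (1/2) 0 / a ^ 0 * (sqrt (pi / a) / 2) * exp (- z) * hyp1F1 (- real 0) (1/2) z"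
    using gauss_cos_0[OF assms(1)] by (simp add: z_def hyp1F1_neg_nat[of 0, simplified])
  have "2 * a * gauss_sin a w (Suc 0) = w * gauss_cos a w 0"
    using gauss_sin_rec[OF assms(1), of w 0] by simp
  then have "gauss_sin a w (Suc 0) = w * gauss_cos a w 0 / (2 * a)"
    using assms(1) by (simp add: field_simps)
  then show "gauss_sin a w (2 * 0 + 1) =
          pochhammer (3/2) 0 / a ^ 0 * (w / (4 * a)) * sqrt (pi / a) * exp (- z) * hyp1F1 (- real 0) (3/2) z"
    using gauss_cos_0[OF assms(1), of w] by (simp add: z_def hyp1F1_neg_nat[of 0, simplified])
next
  case (Suc j)
  define E where "E = sqrt (pi / a) * exp (- z)"
  define p where "p = pochhammer (1/2 :: real) j"
  define q where "q = (\<lambda>j. hyp1F1 (- real j) (1/2) z)"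
  define h where "h = (\<lambda>j. hyp1F1 (- real j) (3/2) z)"
  have w2: "w * w = 4 * a * z" using assms by (simp add: z_def power2_eq_square)
  have p3: "pochhammer (3/2) j = (2 * real j + 1) * p" "pochhammer (3/2) (Suc j) = (2 * real j + 3) / 2 * ((2 * real j + 1) * p)"
    "pochhammer (1/2) (Suc j) = (2 * real j + 1) / 2 * p"
    unfolding p_def by (auto simp: pochhammer_half_ratio pochhammer_Suc field_simps)
  have C: "gauss_cos a w (2 * j) = p / a ^ j * E / 2 * q j"
    and S: "gauss_sin a w (2 * j + 1) = (2 * real j + 1) * p / a ^ j * (w / (4 * a)) * E * h j"
    using Suc by (simp_all add: E_def p_def q_def h_def pochhammer_half_ratio)
  have "2 * a * gauss_cos a w (2 * Suc j) = (2 * real j + 1) * gauss_cos a w (2 * j) - w * gauss_sin a w (2 * j + 1)"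
    using gauss_cos_rec[OF assms(1), of w "2 * j + 1"] by simp
  also have "\<dots> = (2 * real j + 1) * p / a ^ j * E / 2 * (q j - (w * w / (2 * a)) * h j)"
    unfolding C S using assms(1) by (simp add: field_simps)
  also have "q j - (w * w / (2 * a)) * h j = q (Suc j)"
    using assms(1) unfolding w2 q_def h_def hyp1F1_contiguous_even by simp
  finally have C': "gauss_cos a w (2 * Suc j) = (2 * real j + 1) / 2 * p / a ^ Suc j * E / 2 * q (Suc j)"
    using assms(1) by (simp add: field_simps)
  then show "gauss_cos a w (2 * Suc j) =
      pochhammer (1/2) (Suc j) / a ^ Suc j * (sqrt (pi / a) / 2) * exp (- z) * hyp1F1 (- real (Suc j)) (1/2) z"
    unfolding p3 q_def E_def by simp
  have "2 * a * gauss_sin a w (2 * Suc j + 1) = 2 * real (Suc j) * gauss_sin a w (2 * j + 1) + w * gauss_cos a w (2 * Suc j)"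
    using gauss_sin_rec[OF assms(1), of w "2 * j + 2"] by simp
  also have "\<dots> = (2 * real j + 1) * p / a ^ j * (w / (4 * a)) * E * (2 * real (Suc j) * h j + q (Suc j))"
    unfolding C' S using assms(1) by (simp add: field_simps)
  also have "2 * real (Suc j) * h j + q (Suc j) = (2 * real (Suc j) + 1) * h (Suc j)"
    unfolding h_def q_def hyp1F1_contiguous_odd ..
  finally have "gauss_sin a w (2 * Suc j + 1) =
      (2 * real j + 3) / 2 * ((2 * real j + 1) * p) / a ^ Suc j * (w / (4 * a)) * E * h (Suc j)"
    using assms(1) by (simp add: field_simps)
  then show "gauss_sin a w (2 * Suc j + 1) =
      pochhammer (3/2) (Suc j) / a ^ Suc j * (w / (4 * a)) * sqrt (pi / a) * exp (- z) * hyp1F1 (- real (Suc j)) (3/2) z"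
    unfolding p3 h_def E_def by simp
qed

subsection \<open>Odd Hermite functions and the transformation formula\<close>

text \<open>For a > 0 this is a constant multiple of H_(2n+1)(t) exp(-t^2/2) at t = sqrt(2a) x, with
  H the Hermite polynomial.\<close>

definition hermite_gauss :: "nat \<Rightarrow> real \<Rightarrow> real \<Rightarrow> real" where
  "hermite_gauss n a x = x * exp (- a * x\<^sup>2) * hyp1F1 (- real n) (3/2) (2 * a * x\<^sup>2)"

lemma hermite_gauss_altdef:
  "hermite_gauss n a x =
     (\<Sum>i\<le>n. (-1) ^ i * real (n choose i) * (2 * a) ^ i / pochhammer (3/2) i * (x ^ (2 * i + 1) * exp (- a * x\<^sup>2)))"
  unfolding hermite_gauss_def hyp1F1_neg_nat sum_distrib_left
  by (intro sum.cong refl) (simp add: power_mult_distrib power_mult [symmetric])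

lemma hermite_gauss_measurable [measurable]: "hermite_gauss n a \<in> borel_measurable borel"
  unfolding hermite_gauss_altdef [abs_def] by measurable

lemma set_integrable_sum:
  fixes f :: "'i \<Rightarrow> real \<Rightarrow> real"
  assumes "\<And>i. i \<in> I \<Longrightarrow> set_integrable M A (f i)"
  shows "set_integrable M A (\<lambda>x. \<Sum>i\<in>I. f i x)"
  using assms unfolding set_integrable_def scaleR_sum_right by (rule Bochner_Integration.integrable_sum)

lemma set_integral_sum_real:
  fixes f :: "'i \<Rightarrow> real \<Rightarrow> real"
  assumes "\<And>i. i \<in> I \<Longrightarrow> set_integrable M A (f i)"
  shows "(LINT x:A|M. \<Sum>i\<in>I. f i x) = (\<Sum>i\<in>I. LINT x:A|M. f i x)"
  using assms unfolding set_integrable_def set_lebesgue_integral_def scaleR_sum_right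
  by (rule Bochner_Integration.integral_sum)

text \<open>The multiplier \<open>g\<close> stays general to cover the sine kernel, the constant 1
  in the form \<open>cos (0 * x)\<close>, and 1/x. As 1/x is unbounded, integrability is assumed for
  each odd moment instead of a bound on \<open>g\<close>.\<close>

lemma
  fixes g :: "real \<Rightarrow> real"
  assumes "a > 0" "\<And>i. set_integrable lborel {0<..} (\<lambda>x. x ^ (2 * i + 1) * exp (- a * x\<^sup>2) * g x)"
  shows set_integrable_hermite_gauss_mult: "set_integrable lborel {0<..} (\<lambda>x. hermite_gauss n a x * g x)"
    and set_integral_hermite_gauss_mult: "(LBINT x:{0<..}. hermite_gauss n a x * g x) =
     (\<Sum>i\<le>n. (-1) ^ i * real (n choose i) * (2 * a) ^ i / pochhammer (3/2) i *
       (LBINT x:{0<..}. x ^ (2 * i + 1) * exp (- a * x\<^sup>2) * g x))"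
proof -
  have eq: "(\<lambda>x. hermite_gauss n a x * g x) = (\<lambda>x. \<Sum>i\<le>n.
      (-1) ^ i * real (n choose i) * (2 * a) ^ i / pochhammer (3/2) i * (x ^ (2 * i + 1) * exp (- a * x\<^sup>2) * g x))"
    unfolding hermite_gauss_altdef sum_distrib_right by (simp only: mult.assoc)
  show "set_integrable lborel {0<..} (\<lambda>x. hermite_gauss n a x * g x)"
    unfolding eq by (intro set_integrable_sum set_integrable_mult_right assms(2))
  show "(LBINT x:{0<..}. hermite_gauss n a x * g x) =
     (\<Sum>i\<le>n. (-1) ^ i * real (n choose i) * (2 * a) ^ i / pochhammer (3/2) i *
       (LBINT x:{0<..}. x ^ (2 * i + 1) * exp (- a * x\<^sup>2) * g x))"
    unfolding eq set_integral_mult_right [symmetric]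
    by (intro set_integral_sum_real set_integrable_mult_right assms(2))
qed

text \<open>The factor (3/2)_i / a^i of the i-th sine moment cancels against the coefficient of the
  polynomial, leaving exactly the weights (n choose i) (-2)^i of
  \<open>sum_binomial_hyp1F1\<close>.\<close>

lemma hermite_gauss_sine_transform:
  fixes a w :: real
  assumes "a > 0"
  shows "(LBINT x:{0<..}. hermite_gauss n a x * sin (w * x)) =
     (-1) ^ n * (w / (4 * a)) * sqrt (pi / a) * exp (- (w\<^sup>2 / (4 * a))) *
       hyp1F1 (- real n) (3/2) (2 * (w\<^sup>2 / (4 * a)))"
proof -
  have "(LBINT x:{0<..}. hermite_gauss n a x * sin (w * x)) =
      (\<Sum>i\<le>n. (-1) ^ i * real (n choose i) * (2 * a) ^ i / pochhammer (3/2) i * gauss_sin a w (2 * i + 1))"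
    unfolding gauss_sin_def
    by (rule set_integral_hermite_gauss_mult[OF assms set_integrable_gauss_sin[OF assms]])
  also have "\<dots> = (\<Sum>i\<le>n. (w / (4 * a)) * sqrt (pi / a) * exp (- (w\<^sup>2 / (4 * a))) *
      (real (n choose i) * (-2) ^ i * hyp1F1 (- real i) (3/2) (w\<^sup>2 / (4 * a))))"
  proof (intro sum.cong refl)
    fix i
    have "(-1) ^ i * (2 * a) ^ i / pochhammer (3/2) i * (pochhammer (3/2) i / a ^ i) = (-2) ^ i"
      using assms pochhammer_half_pos(2)[of i]
      by (simp add: power_mult_distrib power_minus[of "2::real"])
    then have "(-1) ^ i * (2 * a) ^ i / pochhammer (3/2) i * (pochhammer (3/2) i / a ^ i) *
        (real (n choose i) * (w / (4 * a)) * sqrt (pi / a) * exp (- (w\<^sup>2 / (4 * a))) * hyp1F1 (- real i) (3/2) (w\<^sup>2 / (4 * a))) =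
        (-2) ^ i * (real (n choose i) * (w / (4 * a)) * sqrt (pi / a) * exp (- (w\<^sup>2 / (4 * a))) * hyp1F1 (- real i) (3/2) (w\<^sup>2 / (4 * a)))"
      by (simp only:)
    then show "(-1) ^ i * real (n choose i) * (2 * a) ^ i / pochhammer (3/2) i * gauss_sin a w (2 * i + 1) =
       (w / (4 * a)) * sqrt (pi / a) * exp (- (w\<^sup>2 / (4 * a))) *
      (real (n choose i) * (-2) ^ i * hyp1F1 (- real i) (3/2) (w\<^sup>2 / (4 * a)))"
      unfolding gauss_sin_odd[OF assms] by (simp only: mult_ac times_divide_eq_left times_divide_eq_right divide_divide_eq_left)
  qed
  also have "\<dots> = (w / (4 * a)) * sqrt (pi / a) * exp (- (w\<^sup>2 / (4 * a))) *
      ((-1) ^ n * hyp1F1 (- real n) (3/2) (2 * (w\<^sup>2 / (4 * a))))"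
    unfolding sum_distrib_left [symmetric] sum_binomial_hyp1F1 ..
  finally show ?thesis by (simp only: mult_ac)
qed

text \<open>At w = 2 pi x the condition a b = pi^2 turns w^2/(4a) into b x^2. The prefactor inverts
  the amplitude (pi/(2a)) sqrt(pi/a) of the transform.\<close>

lemma hermite_gauss_self_reciprocal:
  fixes a b x :: real
  assumes "a > 0" "b > 0" "a * b = pi\<^sup>2"
  shows "hermite_gauss n b x =
    (-1) ^ n * (2 * a / pi * sqrt (a / pi)) * (LBINT y:{0<..}. hermite_gauss n a y * sin (2 * pi * x * y))"
proof -
  have b: "(2 * pi * x)\<^sup>2 / (4 * a) = b * x\<^sup>2"
    using assms(1) by (simp add: power_mult_distrib assms(3) [symmetric])
  have c: "sqrt (a / pi) * sqrt (pi / a) = 1"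
    using assms(1) by (simp flip: real_sqrt_mult)
  have "(-1) ^ n * (2 * a / pi * sqrt (a / pi)) * (LBINT y:{0<..}. hermite_gauss n a y * sin (2 * pi * x * y)) =
      ((-1) ^ n * (-1) ^ n) * (2 * a / pi * (2 * pi * x / (4 * a))) * (sqrt (a / pi) * sqrt (pi / a)) *
        exp (- (b * x\<^sup>2)) * hyp1F1 (- real n) (3/2) (2 * (b * x\<^sup>2))"
    unfolding hermite_gauss_sine_transform[OF assms(1)] b by (simp only: mult_ac)
  also have "(-1) ^ n * (-1) ^ n = (1 :: real)" by (simp flip: power_add)
  also have "2 * a / pi * (2 * pi * x / (4 * a)) = x" using assms(1) by simp
  finally show ?thesis
    unfolding c by (simp only: hermite_gauss_def[of n b x] mult_1 mult_1_right mult_minus_left mult.assoc)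
qed

section \<open>Integrals of the Hermite functions against 1 and 1/x\<close>

lemma set_integrable_hermite_gauss:
  fixes a :: real
  assumes "a > 0"
  shows "set_integrable lborel {0<..} (hermite_gauss n a)"
proof -
  have "set_integrable lborel {0<..} (\<lambda>x. hermite_gauss n a x * cos (0 * x))"
    by (rule set_integrable_hermite_gauss_mult[OF assms set_integrable_gauss_cos[OF assms]])
  then show ?thesis by simp
qed

lemma gauss_cos_odd_0:
  assumes "a > 0"
  shows "gauss_cos a 0 (2 * i + 1) = fact i / (2 * a ^ (i + 1))"
proof (induction i)
  case 0
  show ?case using gauss_cos_rec[OF assms, of 0 0] assms by (simp add: field_simps)
next
  case (Suc i)
  have "2 * a * gauss_cos a 0 (2 * Suc i + 1) = 2 * (real i + 1) * gauss_cos a 0 (2 * i + 1)"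
    using gauss_cos_rec[OF assms, of 0 "2 * i + 2"] by simp
  also have "\<dots> = 2 * a * (fact (Suc i) / (2 * a ^ (Suc i + 1)))"
    unfolding Suc using assms by (simp add: field_simps)
  finally show ?case using assms by (simp only: mult_cancel_left) simp
qed

text \<open>This evaluates the correction 1/2 of the kernel. The odd Gaussian moments contribute i!
  = (1)_i, which is the upper parameter 1.\<close>

lemma set_integral_hermite_gauss:
  assumes "a > 0"
  shows "(LBINT x:{0<..}. hermite_gauss n a x) = hyp2F1 (- real n) 1 (3/2) 2 / (2 * a)"
proof -
  have "(LBINT x:{0<..}. hermite_gauss n a x * cos (0 * x)) =
      (\<Sum>i\<le>n. (-1) ^ i * real (n choose i) * (2 * a) ^ i / pochhammer (3/2) i * gauss_cos a 0 (2 * i + 1))"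
    unfolding gauss_cos_def
    by (rule set_integral_hermite_gauss_mult[OF assms set_integrable_gauss_cos[OF assms]])
  also have "\<dots> = (\<Sum>i\<le>n. (-1) ^ i * real (n choose i) * pochhammer 1 i * 2 ^ i / pochhammer (3/2) i / (2 * a))"
    unfolding gauss_cos_odd_0[OF assms]
    by (intro sum.cong refl) (use assms in \<open>simp add: power_mult_distrib pochhammer_fact [symmetric]\<close>)
  finally show ?thesis unfolding hyp2F1_neg_nat sum_divide_distrib by simp
qed

text \<open>This evaluates the correction -1/(2 pi y). Division by x turns odd moments into even
  ones, whose (1/2)_i becomes the upper parameter 1/2.\<close>

lemma hermite_gauss_divide:
  fixes a :: real
  assumes "a > 0"
  shows set_integrable_hermite_gauss_divide: "set_integrable lborel {0<..} (\<lambda>x. hermite_gauss n a x / x)"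
    and set_integral_hermite_gauss_divide:
    "(LBINT x:{0<..}. hermite_gauss n a x / x) = sqrt (pi / a) / 2 * hyp2F1 (- real n) (1/2) (3/2) 2"
proof -
  have eq: "x \<in> {0<..} \<Longrightarrow> x ^ (2 * i + 1) * exp (- a * x\<^sup>2) * (1 / x) = x ^ (2 * i) * exp (- a * x\<^sup>2) * cos (0 * x)"
    for i x by auto
  have int: "set_integrable lborel {0<..} (\<lambda>x. x ^ (2 * i + 1) * exp (- a * x\<^sup>2) * (1 / x))" for i
    using set_integrable_gauss_cos[OF assms, of "2 * i" 0]
    by (subst set_integrable_cong[OF refl refl eq]) auto
  show "set_integrable lborel {0<..} (\<lambda>x. hermite_gauss n a x / x)"
    using set_integrable_hermite_gauss_mult[OF assms int] by simp
  have moment: "(LBINT x:{0<..}. x ^ (2 * i + 1) * exp (- a * x\<^sup>2) * (1 / x)) = gauss_cos a 0 (2 * i)" for i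
    unfolding gauss_cos_def by (rule set_lebesgue_integral_cong) (use eq in auto)
  have "(LBINT x:{0<..}. hermite_gauss n a x * (1 / x)) =
      (\<Sum>i\<le>n. (-1) ^ i * real (n choose i) * (2 * a) ^ i / pochhammer (3/2) i * gauss_cos a 0 (2 * i))"
    unfolding set_integral_hermite_gauss_mult[OF assms int] moment ..
  also have "\<dots> = (\<Sum>i\<le>n. sqrt (pi / a) / 2 *
      ((-1) ^ i * real (n choose i) * pochhammer (1/2) i * 2 ^ i / pochhammer (3/2) i))"
    unfolding gauss_cos_even[OF assms]
    by (intro sum.cong refl) (use assms in \<open>simp add: power_mult_distrib hyp1F1_0 mult_ac\<close>)
  finally show "(LBINT x:{0<..}. hermite_gauss n a x / x) = sqrt (pi / a) / 2 * hyp2F1 (- real n) (1/2) (3/2) 2"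
    unfolding hyp2F1_neg_nat sum_distrib_left by simp
qed

section \<open>Laplace transforms and the exchange of integrals and sums\<close>

lemma set_integrable_exp_neg:
  fixes c :: real
  assumes "c > 0"
  shows "set_integrable lborel {0<..} (\<lambda>x. exp (- c * x))"
proof -
  have "set_integrable lborel (einterval 0 \<infinity>) (\<lambda>x. exp (- c * x))"
  proof (rule interval_integral_FTC_nonneg(1))
    show "DERIV (\<lambda>x. - exp (- c * x) / c) x :> exp (- c * x)" for x
      using assms by (auto intro!: derivative_eq_intros)
    have "filterlim (\<lambda>x. - c * x) at_bot at_top"
      using assms by (intro filterlim_tendsto_neg_mult_at_bot[OF tendsto_const] filterlim_ident) auto
    then have "((\<lambda>x. - exp (- c * x) / c) \<longlongrightarrow> - 0 / c) at_top"
      using assms by (intro tendsto_intros filterlim_compose[OF exp_at_bot]) auto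
    then show "(((\<lambda>x. - exp (- c * x) / c) \<circ> real_of_ereal) \<longlongrightarrow> 0) (at_left \<infinity>)"
      by (simp add: ereal_tendsto_simps)
    have "((\<lambda>x. - exp (- c * x) / c) \<longlongrightarrow> - exp (- c * 0) / c) (at_right 0)"
      using assms by (intro tendsto_intros) auto
    then show "(((\<lambda>x. - exp (- c * x) / c) \<circ> real_of_ereal) \<longlongrightarrow> - 1 / c) (at_right 0)"
      unfolding zero_ereal_def by (simp add: ereal_tendsto_simps)
  qed auto
  then show ?thesis unfolding einterval_0_infinity .
qed

lemma laplace_sin:
  fixes c w :: real
  assumes "c > 0"
  shows "(LBINT x:{0<..}. exp (- c * x) * sin (w * x)) = w / (c\<^sup>2 + w\<^sup>2)"
proof -
  define F where "F = (\<lambda>x. exp (- c * x) * - (c * sin (w * x) + w * cos (w * x)) / (c\<^sup>2 + w\<^sup>2))"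
  have pos: "c\<^sup>2 + w\<^sup>2 > 0" using assms by (simp add: add_pos_nonneg)
  have "(LBINT x:{0<..}. exp (- c * x) * sin (w * x)) = 0 - F 0"
  proof (rule set_integral_FTC_Ioi)
    show "(F has_field_derivative exp (- c * x) * sin (w * x)) (at x)" for x
    proof -
      have "((\<lambda>x. exp (- c * x) * - (c * sin (w * x) + w * cos (w * x))) has_field_derivative
          exp (- c * x) * sin (w * x) * (c\<^sup>2 + w\<^sup>2)) (at x)"
        by (auto intro!: derivative_eq_intros simp: algebra_simps power2_eq_square)
      from DERIV_cdivide[OF this, of "c\<^sup>2 + w\<^sup>2"] show ?thesis using pos assms by (simp add: F_def)
    qed
    show "continuous_on UNIV (\<lambda>x. exp (- c * x) * sin (w * x))" by (intro continuous_intros)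
    show "set_integrable lborel {0<..} (\<lambda>x. exp (- c * x) * sin (w * x))"
      by (rule set_integrable_mult_bounded[where C = 1, OF set_integrable_exp_neg[OF assms]]) auto
    show "(F \<longlongrightarrow> 0) at_top"
    proof (rule Lim_null_comparison)
      have "filterlim (\<lambda>x. - c * x) at_bot at_top"
        using assms by (intro filterlim_tendsto_neg_mult_at_bot[OF tendsto_const] filterlim_ident) auto
      then have "((\<lambda>x. exp (- c * x) * ((c + \<bar>w\<bar>) / (c\<^sup>2 + w\<^sup>2))) \<longlongrightarrow> 0 * ((c + \<bar>w\<bar>) / (c\<^sup>2 + w\<^sup>2))) at_top"
        using pos by (intro tendsto_intros filterlim_compose[OF exp_at_bot]) auto
      then show "((\<lambda>x. exp (- c * x) * ((c + \<bar>w\<bar>) / (c\<^sup>2 + w\<^sup>2))) \<longlongrightarrow> 0) at_top" by simp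
      show "\<forall>\<^sub>F x in at_top. norm (F x) \<le> exp (- c * x) * ((c + \<bar>w\<bar>) / (c\<^sup>2 + w\<^sup>2))"
      proof (intro always_eventually allI)
        fix x
        have "\<bar>c * sin (w * x) + w * cos (w * x)\<bar> \<le> \<bar>c * sin (w * x)\<bar> + \<bar>w * cos (w * x)\<bar>"
          by (rule abs_triangle_ineq)
        also have "\<dots> \<le> c + \<bar>w\<bar>"
          using assms by (intro add_mono) (auto simp: abs_mult intro!: mult_left_le)
        finally show "norm (F x) \<le> exp (- c * x) * ((c + \<bar>w\<bar>) / (c\<^sup>2 + w\<^sup>2))"
          using pos unfolding F_def by (simp add: abs_mult divide_right_mono)
      qed
    qed
  qed
  then show ?thesis by (simp add: F_def)
qed

text \<open>Fubini applies because |sin| <= 1 bounds the integrand by exp(-c x) |f y|, a product of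
  integrable functions of one variable. The inner integral over x is then \<open>laplace_sin\<close>
  with frequency v y.\<close>

lemma laplace_of_sine_transform:
  fixes f :: "real \<Rightarrow> real" and c v :: real
  assumes c: "c > 0" and f: "set_integrable lborel {0<..} f" and [measurable]: "f \<in> borel_measurable borel"
  shows "(LBINT x:{0<..}. exp (- c * x) * (LBINT y:{0<..}. f y * sin (v * x * y))) =
         (LBINT y:{0<..}. f y * (v * y / (c\<^sup>2 + (v * y)\<^sup>2)))"
proof -
  let ?I = "indicator {0<..} :: real \<Rightarrow> real"
  define H where "H = (\<lambda>(x, y). ?I x * exp (- c * x) * (?I y * f y) * sin (v * x * y))"
  have H_meas [measurable]: "H \<in> borel_measurable (lborel \<Otimes>\<^sub>M lborel)" unfolding H_def by measurable
  have e: "integrable lborel (\<lambda>x. ?I x * exp (- c * x))"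
    using set_integrable_exp_neg[OF c] by (simp add: set_integrable_def)
  have f': "integrable lborel (\<lambda>y. ?I y * f y)"
    using f by (simp add: set_integrable_def)
  have int_y: "integrable lborel (\<lambda>y. H (x, y))" for x
  proof (rule Bochner_Integration.integrable_bound)
    show "integrable lborel (\<lambda>y. ?I x * exp (- c * x) * (?I y * f y))" using f' by simp
    show "AE y in lborel. norm (H (x, y)) \<le> norm (?I x * exp (- c * x) * (?I y * f y))"
      unfolding H_def by (intro AE_I2) (auto simp: abs_mult intro!: mult_left_le)
  qed measurable
  have "integrable (lborel \<Otimes>\<^sub>M lborel) H"
  proof (rule lborel_pair.Fubini_integrable)
    show "integrable lborel (\<lambda>x. \<integral>y. norm (H (x, y)) \<partial>lborel)"
    proof (rule Bochner_Integration.integrable_bound)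
      show "integrable lborel (\<lambda>x. ?I x * exp (- c * x) * (\<integral>y. norm (?I y * f y) \<partial>lborel))"
        using e by simp
      show "AE x in lborel. norm (\<integral>y. norm (H (x, y)) \<partial>lborel) \<le>
          norm (?I x * exp (- c * x) * (\<integral>y. norm (?I y * f y) \<partial>lborel))"
      proof (intro AE_I2)
        fix x
        have "(\<integral>y. norm (H (x, y)) \<partial>lborel) \<le> (\<integral>y. ?I x * exp (- c * x) * norm (?I y * f y) \<partial>lborel)"
        proof (rule integral_mono)
          show "integrable lborel (\<lambda>y. norm (H (x, y)))" using int_y by simp
          show "integrable lborel (\<lambda>y. ?I x * exp (- c * x) * norm (?I y * f y))" using f' by simp
          show "norm (H (x, y)) \<le> ?I x * exp (- c * x) * norm (?I y * f y)" for y
            unfolding H_def by (auto simp: abs_mult intro!: mult_left_le)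
        qed
        then show "norm (\<integral>y. norm (H (x, y)) \<partial>lborel) \<le>
          norm (?I x * exp (- c * x) * (\<integral>y. norm (?I y * f y) \<partial>lborel))"
          by (simp add: abs_mult)
      qed
    qed measurable
  qed (use int_y in auto)
  then have "(\<integral>y. (\<integral>x. H (x, y) \<partial>lborel) \<partial>lborel) = (\<integral>x. (\<integral>y. H (x, y) \<partial>lborel) \<partial>lborel)"
    using lborel_pair.Fubini_integral[of "\<lambda>x y. H (x, y)"] by simp
  also have "(\<integral>x. (\<integral>y. H (x, y) \<partial>lborel) \<partial>lborel) =
      (LBINT x:{0<..}. exp (- c * x) * (LBINT y:{0<..}. f y * sin (v * x * y)))"
    unfolding set_lebesgue_integral_def H_def
    by (simp add: mult.assoc)
  also have "(\<integral>y. (\<integral>x. H (x, y) \<partial>lborel) \<partial>lborel) =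
      (LBINT y:{0<..}. f y * (LBINT x:{0<..}. exp (- c * x) * sin (v * y * x)))"
    unfolding set_lebesgue_integral_def H_def
    by (simp add: mult_ac)
  also have "\<dots> = (LBINT y:{0<..}. f y * (v * y / (c\<^sup>2 + (v * y)\<^sup>2)))"
    unfolding laplace_sin[OF c] ..
  finally show ?thesis ..
qed

text \<open>As the \<open>h i\<close> are nonnegative, partial sums of the kernel stay below
  \<open>H\<close>, so |f H| dominates whatever the sign of \<open>f\<close>. It serves both the
  geometric and the partial fraction expansion.\<close>

lemma set_integral_sums_kernel:
  fixes f H :: "real \<Rightarrow> real" and h :: "nat \<Rightarrow> real \<Rightarrow> real"
  assumes [measurable]: "f \<in> borel_measurable borel" "\<And>i. h i \<in> borel_measurable borel"
    and fH: "set_integrable lborel {0<..} (\<lambda>x. f x * H x)"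
    and nonneg: "\<And>i x. x > 0 \<Longrightarrow> h i x \<ge> 0"
    and sums: "\<And>x. x > 0 \<Longrightarrow> (\<lambda>i. h i x) sums H x"
  shows "(\<lambda>i. LBINT x:{0<..}. f x * h i x) sums (LBINT x:{0<..}. f x * H x)"
proof -
  let ?I = "indicator {0<..} :: real \<Rightarrow> real"
  have partial_le: "(\<Sum>i<N. h i x) \<le> H x" if "x > 0" for N x
    using sum_le_suminf[OF sums_summable[OF sums[OF that]], of "{..<N}"] nonneg[OF that] sums_unique[OF sums[OF that]]
    by simp
  have int: "set_integrable lborel {0<..} (\<lambda>x. f x * h i x)" for i
  proof (rule set_integrable_bound[OF fH])
    show "set_borel_measurable lborel {0<..} (\<lambda>x. f x * h i x)" by measurable
    show "AE x in lborel. x \<in> {0<..} \<longrightarrow> norm (f x * h i x) \<le> norm (f x * H x)"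
    proof (intro AE_I2 impI)
      fix x :: real assume "x \<in> {0<..}"
      then have "h i x \<le> (\<Sum>j<Suc i. h j x)" "0 \<le> h i x"
        using nonneg by (auto intro!: sum_nonneg)
      then have "\<bar>h i x\<bar> \<le> \<bar>H x\<bar>" using partial_le[of x "Suc i"] \<open>x \<in> {0<..}\<close> by auto
      then show "norm (f x * h i x) \<le> norm (f x * H x)"
        by (simp add: abs_mult mult_left_mono)
    qed
  qed
  have "(\<lambda>N. \<integral>x. ?I x * (f x * (\<Sum>i<N. h i x)) \<partial>lborel) \<longlonglongrightarrow> (\<integral>x. ?I x * (f x * H x) \<partial>lborel)"
  proof (rule integral_dominated_convergence[where w = "\<lambda>x. norm (?I x * (f x * H x))"])
    show "(\<lambda>x. ?I x * (f x * H x)) \<in> borel_measurable lborel"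
      using fH unfolding set_integrable_def by (auto dest: borel_measurable_integrable)
    show "integrable lborel (\<lambda>x. norm (?I x * (f x * H x)))"
      using fH unfolding set_integrable_def by (simp del: norm_mult)
    show "AE x in lborel. (\<lambda>N. ?I x * (f x * (\<Sum>i<N. h i x))) \<longlonglongrightarrow> ?I x * (f x * H x)"
      using sums by (intro AE_I2) (auto simp: sums_def split: split_indicator intro!: tendsto_intros)
    show "AE x in lborel. norm (?I x * (f x * (\<Sum>i<N. h i x))) \<le> norm (?I x * (f x * H x))" for N
    proof (intro AE_I2)
      fix x :: real
      have "x > 0 \<Longrightarrow> \<bar>\<Sum>i<N. h i x\<bar> \<le> \<bar>H x\<bar>"
        using partial_le[of x N] sum_nonneg[of "{..<N}" "\<lambda>i. h i x"] nonneg by force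
      then show "norm (?I x * (f x * (\<Sum>i<N. h i x))) \<le> norm (?I x * (f x * H x))"
        by (auto simp: abs_mult mult_left_mono split: split_indicator)
    qed
  qed measurable
  moreover have "(\<integral>x. ?I x * (f x * (\<Sum>i<N. h i x)) \<partial>lborel) = (\<Sum>i<N. LBINT x:{0<..}. f x * h i x)" for N
    unfolding set_integral_sum_real[OF int, symmetric] unfolding set_lebesgue_integral_def
    by (simp add: sum_distrib_left)
  ultimately show ?thesis by (simp add: sums_def set_lebesgue_integral_def)
qed

section \<open>The Planck kernel and the transformation formula\<close>

lemma set_integrable_hermite_gauss_planck:
  fixes a :: real
  assumes "a > 0"
  shows "set_integrable lborel {0<..} (\<lambda>x. hermite_gauss n a x * (1 / (exp (2 * pi * x) - 1)))"
proof (rule set_integrable_bound)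
  show "set_integrable lborel {0<..} (\<lambda>x. hermite_gauss n a x / x)"
    by (rule set_integrable_hermite_gauss_divide[OF assms])
  show "set_borel_measurable lborel {0<..} (\<lambda>x. hermite_gauss n a x * (1 / (exp (2 * pi * x) - 1)))"
    by measurable
  show "AE x in lborel. x \<in> {0<..} \<longrightarrow>
      norm (hermite_gauss n a x * (1 / (exp (2 * pi * x) - 1))) \<le> norm (hermite_gauss n a x / x)"
  proof (intro AE_I2 impI)
    fix x :: real assume x: "x \<in> {0<..}"
    \<comment> \<open>From exp t - 1 >= t the kernel is at most 1/x, so the pole at 0 is absorbed by
      the factor x of the Hermite function.\<close>
    have "x \<le> 2 * pi * x" using x pi_gt3 by simp
    also have "\<dots> \<le> exp (2 * pi * x) - 1" using exp_ge_add_one_self[of "2 * pi * x"] by linarith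
    finally have "1 / (exp (2 * pi * x) - 1) \<le> 1 / x" "x \<le> exp (2 * pi * x) - 1" using x by (auto intro: frac_le)
    then have "\<bar>1 / (exp (2 * pi * x) - 1)\<bar> \<le> \<bar>1 / x\<bar>" using x by simp
    then have "\<bar>hermite_gauss n a x\<bar> * \<bar>1 / (exp (2 * pi * x) - 1)\<bar> \<le> \<bar>hermite_gauss n a x\<bar> * \<bar>1 / x\<bar>"
      by (intro mult_left_mono) auto
    then show "norm (hermite_gauss n a x * (1 / (exp (2 * pi * x) - 1))) \<le> norm (hermite_gauss n a x / x)"
      by (simp add: abs_mult)
  qed
qed

lemma planck_geometric_sums:
  fixes x :: real
  assumes "x > 0"
  shows "(\<lambda>k. exp (- (2 * pi * real (Suc k)) * x)) sums (1 / (exp (2 * pi * x) - 1))"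
proof -
  have lt: "exp (- (2 * pi * x)) < 1" using assms by simp
  then have "(\<lambda>k. exp (- (2 * pi * x)) * exp (- (2 * pi * x)) ^ k) sums
      (exp (- (2 * pi * x)) * (1 / (1 - exp (- (2 * pi * x)))))"
    by (intro sums_mult geometric_sums) auto
  also have "(\<lambda>k. exp (- (2 * pi * x)) * exp (- (2 * pi * x)) ^ k) = (\<lambda>k. exp (- (2 * pi * real (Suc k)) * x))"
    by (simp add: exp_of_nat_mult [symmetric] exp_add [symmetric] fun_eq_iff algebra_simps)
  also have "exp (- (2 * pi * x)) * (1 / (1 - exp (- (2 * pi * x)))) = 1 / (exp (2 * pi * x) - 1)"
    using lt by (simp add: exp_minus field_simps)
  finally show ?thesis .
qed

(* The sum over k of the Laplace transforms at 2 pi (k + 1) is K b by the geometric series.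
   Replacing hermite_gauss n b by the sine transform of hermite_gauss n a turns each summand into
   an integral against a term of planck_partial_fractions. *)
lemma planck_transform:
  fixes a b :: real and n :: nat
  assumes ab: "a > 0" "b > 0" "a * b = pi\<^sup>2"
  defines "K \<equiv> \<lambda>a. LBINT x:{0<..}. hermite_gauss n a x * (1 / (exp (2 * pi * x) - 1))"
  shows "K b = (-1) ^ n * (a / pi * sqrt (a / pi)) *
    (K a - sqrt (pi / a) / (4 * pi) * hyp2F1 (- real n) (1/2) (3/2) 2 + hyp2F1 (- real n) 1 (3/2) 2 / (4 * a))"
proof -
  define C where "C = (-1) ^ n * (2 * a / pi * sqrt (a / pi))"
  let ?f = "hermite_gauss n a"
  let ?P = "\<lambda>y. 1 / (exp (2 * pi * y) - 1) - 1 / (2 * pi * y) + 1 / 2"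
  have planck: "set_integrable lborel {0<..} (\<lambda>y. ?f y * (1 / (exp (2 * pi * y) - 1)))"
    by (rule set_integrable_hermite_gauss_planck[OF ab(1)])
  have inv: "set_integrable lborel {0<..} (\<lambda>y. 1 / (2 * pi) * (?f y / y))"
    by (intro set_integrable_mult_right set_integrable_hermite_gauss_divide[OF ab(1)])
  have half: "set_integrable lborel {0<..} (\<lambda>y. 1 / 2 * ?f y)"
    by (intro set_integrable_mult_right set_integrable_hermite_gauss[OF ab(1)])
  have eq: "(\<lambda>y. ?f y * ?P y) = (\<lambda>y. ?f y * (1 / (exp (2 * pi * y) - 1)) - 1 / (2 * pi) * (?f y / y) + 1 / 2 * ?f y)"
    by (simp add: fun_eq_iff algebra_simps)
  have fP: "set_integrable lborel {0<..} (\<lambda>y. ?f y * ?P y)"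
    unfolding eq by (intro set_integral_add(1) set_integral_diff(1) planck inv half)
  have "(LBINT y:{0<..}. ?f y * ?P y) = K a - 1 / (2 * pi) * (LBINT y:{0<..}. ?f y / y) + 1 / 2 * (LBINT y:{0<..}. ?f y)"
    unfolding eq K_def set_integral_add(2)[OF set_integral_diff(1)[OF planck inv] half]
      set_integral_diff(2)[OF planck inv] set_integral_mult_right ..
  also have "\<dots> = K a - sqrt (pi / a) / (4 * pi) * hyp2F1 (- real n) (1/2) (3/2) 2 + hyp2F1 (- real n) 1 (3/2) 2 / (4 * a)"
    unfolding set_integral_hermite_gauss[OF ab(1)] set_integral_hermite_gauss_divide[OF ab(1)] by simp
  finally have int_fP: "(LBINT y:{0<..}. ?f y * ?P y) = \<dots>" .
  have sums_b: "(\<lambda>k. LBINT x:{0<..}. hermite_gauss n b x * exp (- (2 * pi * real (Suc k)) * x)) sums K b"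
    unfolding K_def
    by (rule set_integral_sums_kernel)
       (use planck_geometric_sums set_integrable_hermite_gauss_planck[OF ab(2)] in auto)
  have term_eq: "(LBINT x:{0<..}. hermite_gauss n b x * exp (- (2 * pi * real (Suc k)) * x)) =
      C / 2 * (LBINT y:{0<..}. ?f y * (y / (pi * (real (Suc k) ^ 2 + y\<^sup>2))))" for k
  proof -
    have "(LBINT x:{0<..}. hermite_gauss n b x * exp (- (2 * pi * real (Suc k)) * x)) =
        (LBINT x:{0<..}. C * (exp (- (2 * pi * real (Suc k)) * x) * (LBINT y:{0<..}. ?f y * sin (2 * pi * x * y))))"
      unfolding hermite_gauss_self_reciprocal[OF ab, of n] C_def by (simp only: mult_ac)
    also have "\<dots> = C * (LBINT y:{0<..}. ?f y * (2 * pi * y / ((2 * pi * real (Suc k))\<^sup>2 + (2 * pi * y)\<^sup>2)))"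
      unfolding set_integral_mult_right
      by (subst laplace_of_sine_transform) (auto intro!: set_integrable_hermite_gauss[OF ab(1)])
    \<comment> \<open>Cancelling 2 pi leaves y / (2 pi (m^2 + y^2)) with m = k + 1, half a term of
      the partial fraction series; hence the factor \<open>C / 2\<close>.\<close>
    also have "(\<lambda>y. ?f y * (2 * pi * y / ((2 * pi * real (Suc k))\<^sup>2 + (2 * pi * y)\<^sup>2))) =
        (\<lambda>y. 1 / 2 * (?f y * (y / (pi * (real (Suc k) ^ 2 + y\<^sup>2)))))"
    proof
      fix y :: real
      have "2 * pi * y / ((2 * pi * real (Suc k))\<^sup>2 + (2 * pi * y)\<^sup>2) =
          (2 * pi * y) / (2 * pi * (2 * (pi * (real (Suc k) ^ 2 + y\<^sup>2))))"
        by (simp add: power2_eq_square algebra_simps)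
      also have "\<dots> = y / (2 * (pi * (real (Suc k) ^ 2 + y\<^sup>2)))"
        by (subst mult_divide_mult_cancel_left) auto
      finally show "?f y * (2 * pi * y / ((2 * pi * real (Suc k))\<^sup>2 + (2 * pi * y)\<^sup>2)) =
        1 / 2 * (?f y * (y / (pi * (real (Suc k) ^ 2 + y\<^sup>2))))" by simp
    qed
    finally show ?thesis unfolding set_integral_mult_right by simp
  qed
  have sums_a: "(\<lambda>k. C / 2 * (LBINT y:{0<..}. ?f y * (y / (pi * (real (Suc k) ^ 2 + y\<^sup>2))))) sums
      (C / 2 * (LBINT y:{0<..}. ?f y * ?P y))"
    by (intro sums_mult set_integral_sums_kernel fP)
       (use planck_partial_fractions in \<open>auto simp: add_nonneg_nonneg\<close>)
  have "K b = C / 2 * (LBINT y:{0<..}. ?f y * ?P y)"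
    by (rule sums_unique2[OF sums_b[unfolded term_eq] sums_a])
  then show ?thesis unfolding int_fP C_def by simp
qed

theorem theorem1p5:
  fixes \<alpha> \<beta> :: real and k :: nat
  assumes "\<alpha> > 0" and "\<beta> > 0" and "\<alpha> * \<beta> = pi ^ 2"
  shows "set_integrable lborel {0<..}
           (\<lambda>x. x * exp (- \<alpha> * x ^ 2) / (exp (2 * pi * x) - 1)
                 * hyp1F1 (- 2 * real k) (3 / 2) (2 * \<alpha> * x ^ 2))
       \<and> set_integrable lborel {0<..}
           (\<lambda>x. x * exp (- \<beta> * x ^ 2) / (exp (2 * pi * x) - 1)
                 * hyp1F1 (- 2 * real k) (3 / 2) (2 * \<beta> * x ^ 2))
       \<and> \<alpha> powr (- 1 / 4) * hyp2F1 (- 2 * real k) 1 (3 / 2) 2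
           + 4 * \<alpha> powr (3 / 4) *
             (LBINT x:{0<..}. x * exp (- \<alpha> * x ^ 2) / (exp (2 * pi * x) - 1)
                 * hyp1F1 (- 2 * real k) (3 / 2) (2 * \<alpha> * x ^ 2))
         = \<beta> powr (- 1 / 4) * hyp2F1 (- 2 * real k) 1 (3 / 2) 2
           + 4 * \<beta> powr (3 / 4) *
             (LBINT x:{0<..}. x * exp (- \<beta> * x ^ 2) / (exp (2 * pi * x) - 1)
                 * hyp1F1 (- 2 * real k) (3 / 2) (2 * \<beta> * x ^ 2))"
proof -
  define K where "K a = (LBINT x:{0<..}. hermite_gauss (2 * k) a x * (1 / (exp (2 * pi * x) - 1)))" for a
  define B where "B = hyp2F1 (- real (2 * k)) 1 (3/2) 2"
  have integrand: "(\<lambda>x. x * exp (- a * x ^ 2) / (exp (2 * pi * x) - 1)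
                 * hyp1F1 (- 2 * real k) (3 / 2) (2 * a * x ^ 2)) =
      (\<lambda>x. hermite_gauss (2 * k) a x * (1 / (exp (2 * pi * x) - 1)))" for a :: real
    by (simp add: hermite_gauss_def fun_eq_iff)
  \<comment> \<open>The index 2k is even, so the sign in \<open>hyp2F1_pfaff_at_2\<close> disappears
    and both corrections carry the same moment.\<close>
  have B_eq: "hyp2F1 (- real (2 * k)) (1/2) (3/2) 2 = B"
    unfolding B_def hyp2F1_pfaff_at_2 by simp
  \<comment> \<open>With the fourth roots q of \<alpha> and s of pi, the fourth root of \<beta> is
    s^2/q, and all real powers become integer powers of q and s.\<close>
  define q where "q = sqrt (sqrt \<alpha>)"
  define s where "s = sqrt (sqrt pi)"
  have q: "q > 0" "\<alpha> = q ^ 4" and s: "s > 0" "pi = s ^ 4"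
    using assms(1) by (simp_all add: q_def s_def power2_eq_square power4_eq_xxxx mult.assoc [symmetric])
      (simp_all add: mult.assoc)
  have \<beta>: "\<beta> = (s ^ 2 / q) ^ 4"
  proof -
    have "\<beta> = pi\<^sup>2 / \<alpha>" using assms by (simp add: field_simps)
    then show ?thesis unfolding q(2) s(2) by (simp add: power_divide flip: power_mult)
  qed
  have sqrts: "sqrt (\<alpha> / pi) = (q / s) ^ 2" "sqrt (pi / \<alpha>) = (s / q) ^ 2"
    using q s by (auto intro!: real_sqrt_unique simp: power_divide simp flip: power_mult)
  have pow: "(x ^ 4) powr (- 1 / 4) = 1 / x" "(x ^ 4) powr (3 / 4) = x ^ 3" if "x > 0" for x :: real
  proof -
    have "x ^ 4 = x powr 4" using that by simp
    then have "(x ^ 4) powr e = x powr (4 * e)" for e by (simp only: powr_powr)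
    from this[of "- 1 / 4"] this[of "3 / 4"] that
    show "(x ^ 4) powr (- 1 / 4) = 1 / x" "(x ^ 4) powr (3 / 4) = x ^ 3"
      by (simp_all add: powr_minus_divide)
  qed
  have K\<beta>: "K \<beta> = \<alpha> / pi * sqrt (\<alpha> / pi) * (K \<alpha> - sqrt (pi / \<alpha>) / (4 * pi) * B + B / (4 * \<alpha>))"
    using planck_transform[OF assms, of "2 * k"]
    unfolding K_def [symmetric] B_def [symmetric] B_eq by simp
  have scale: "(s\<^sup>2 / q) ^ 3 * (\<alpha> / pi * sqrt (\<alpha> / pi)) = q ^ 3"
    unfolding sqrts unfolding q(2) s(2) using q(1) s(1)
    by (simp add: divide_simps power2_eq_square power3_eq_cube power4_eq_xxxx)
  \<comment> \<open>The pole correction acquires the weight \<beta>^(-1/4); its negative sign moves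
    it to the \<beta> side of the identity.\<close>
  have coeff_A: "4 * q ^ 3 * (sqrt (pi / \<alpha>) / (4 * pi)) = 1 / (s\<^sup>2 / q)"
    unfolding sqrts unfolding q(2) s(2) using q(1) s(1)
    by (simp add: divide_simps power2_eq_square power3_eq_cube power4_eq_xxxx)
  \<comment> \<open>The correction 1/2 acquires the weight \<alpha>^(-1/4) and stays on the \<alpha>
    side.\<close>
  have coeff_B: "4 * q ^ 3 * (B / (4 * \<alpha>)) = 1 / q * B"
    unfolding q(2) using q(1) by (simp add: divide_simps power3_eq_cube power4_eq_xxxx)
  have "4 * (s\<^sup>2 / q) ^ 3 * K \<beta> = 4 * ((s\<^sup>2 / q) ^ 3 * (\<alpha> / pi * sqrt (\<alpha> / pi))) *
      (K \<alpha> - sqrt (pi / \<alpha>) / (4 * pi) * B + B / (4 * \<alpha>))"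
    unfolding K\<beta> by (simp only: mult.assoc)
  also have "\<dots> = 4 * q ^ 3 * K \<alpha> - 4 * q ^ 3 * (sqrt (pi / \<alpha>) / (4 * pi)) * B + 4 * q ^ 3 * (B / (4 * \<alpha>))"
    unfolding scale by (simp only: distrib_left right_diff_distrib mult.assoc)
  also have "\<dots> = 4 * q ^ 3 * K \<alpha> - 1 / (s\<^sup>2 / q) * B + 1 / q * B"
    unfolding coeff_A coeff_B ..
  finally have "1 / q * B + 4 * q ^ 3 * K \<alpha> = 1 / (s\<^sup>2 / q) * B + 4 * (s\<^sup>2 / q) ^ 3 * K \<beta>"
    by linarith
  moreover have "\<alpha> powr (- 1 / 4) = 1 / q" "\<alpha> powr (3 / 4) = q ^ 3"
    using pow[OF q(1)] by (simp_all add: q(2))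
  moreover have "\<beta> powr (- 1 / 4) = 1 / (s\<^sup>2 / q)" "\<beta> powr (3 / 4) = (s\<^sup>2 / q) ^ 3"
    using pow[of "s\<^sup>2 / q"] q(1) s(1) unfolding \<beta> by simp_all
  ultimately have "\<alpha> powr (- 1 / 4) * B + 4 * \<alpha> powr (3 / 4) * K \<alpha> = \<beta> powr (- 1 / 4) * B + 4 * \<beta> powr (3 / 4) * K \<beta>"
    by (simp only:)
  then show ?thesis
    unfolding integrand K_def B_def
    using set_integrable_hermite_gauss_planck assms(1,2) by simp
qed

end
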